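(* Let $\mathbf{T}$ be a pile of quadrangulations of a polygon such that $\varkappa=\varkappa(\mathbf{T})$ is comfortable. Then every coherent solution $\mathbf{x}=(x_s)_{s\in\varkappa^0}$ of the Kashaev equation with all components nonzero and with $x_{v_1}x_{v_3}+x_{v_2}x_{v_4}\neq0$ for every $2$-face of $\varkappa$ with vertices $v_1,v_2,v_3,v_4$ in cyclic order can be extended to an array $\tilde{\mathbf{x}}=(x_s)_{s\in\varkappa^{02}}$ satisfying the K-hexahedron equations.
   Context: A quadrangulation of a polygon $R\subset\mathbb{R}^2$ is a face-to-face tiling by quadrilaterals. A flip replaces three quadrilaterals forming a hexagon with common degree-$3$ interior vertex $w$ by the other subdivision of the hexagon into three quadrilaterals (new interior vertex $v$). A pile is a sequence $(T_0,\dots,T_\ell)$ with consecutive quadrangulations related by a flip. $\varkappa(\mathbf{T})$: start with $T_0$; for each flip add the new vertex $v$ and a $3$-cube with vertices $w,v$ and the six hexagon vertices, whose $2$-faces are the three old and three new quadrilaterals, with bottom vertex $w$ and top vertex $v$. $\varkappa^0,\varkappa^2,\varkappa^3$: vertices, $2$-faces, $3$-cubes; $\varkappa^{02}=\varkappa^0\cup\varkappa^2$. A vertex is interior if it has a neighbourhood homeomorphic to an open ball in $\mathbb{R}^3$. Comfortable: with $\sim$ the equivalence relation on $\varkappa^2$ generated by opposite faces of $3$-cubes, $\varkappa_\boxdot$ its classes, and $\psi_\varkappa(\mathbf{t})_C=t_{[a]}t_{[b]}t_{[c]}$ ($a,b,c$ representing the three pairs of opposite faces of $C$), every $\mathbf{u}\in\{-1,1\}^{\varkappa^3}$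 with $\prod_{C\ni v}u_C=1$ for all interior vertices $v$ lies in the image of $\psi_\varkappa$ (the converse always holds). For a $3$-cube $C$ with vertex values $z_{ijk}$ (cube isomorphism $C\cong\{0,1\}^3$): $K^C=2(a^2+b^2+c^2+d^2)-(a+b+c+d)^2-4(s+t)$ with $a=z_{000}z_{111}$, $b=z_{100}z_{011}$, $c=z_{010}z_{101}$, $d=z_{001}z_{110}$, $s=z_{000}z_{011}z_{101}z_{110}$, $t=z_{111}z_{100}z_{010}z_{001}$; for a vertex $v$ labeled $000$, $K^C_v=\frac12(z_{111}z_{000}^2-z_{000}(z_{100}z_{011}+z_{010}z_{101}+z_{001}z_{110}))-z_{100}z_{010}z_{001}$. A coherent solution of the Kashaev equation: $K^C(\mathbf{x})=0$ for all $3$-cubes, and for every interior vertex $v$, $\prod_{C\ni v}K^C_v(\mathbf{x})=\prod_{S\ni v}(x_vx_{v_2}+x_{v_1}x_{v_3})$ (over $3$-cubes and $2$-faces containing $v$; $v,v_1,v_2,v_3$ in cyclic order on $S$). K-hexahedron equations for $\tilde{\mathbf{x}}$ (nonzero on vertices): $x_s^2=x_{v_1}x_{v_3}+x_{v_2}x_{v_4}$ for each $2$-face $s$ (vertices in cyclic order), and for each $3$-cube, identified with $[0,1]^3$ with bottom $000$ and top $111$, with $z_{ijk}$ vertex values and $z_p$ the value at the face centered at $p$: $z_{1\frac12\frac12}=(z_{\frac120\frac12}z_{\frac12\frac120}+z_{0\frac12\frac12}z_{100})/z_{000}$, $z_{\frac121\frac12}=(z_{0\frac12\frac12}z_{\frac12\frac120}+z_{\frac120\frac12}z_{010})/z_{000}$,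 $z_{\frac12\frac121}=(z_{0\frac12\frac12}z_{\frac120\frac12}+z_{\frac12\frac120}z_{001})/z_{000}$, $z_{111}=(A+2z_{0\frac12\frac12}z_{\frac120\frac12}z_{\frac12\frac120})/z_{000}^2$, $A=2z_{100}z_{010}z_{001}+z_{000}(z_{100}z_{011}+z_{010}z_{101}+z_{001}z_{110})$. *)

theory Defs
  imports "HOL-Analysis.Analysis"
begin

type_synonym pt = "real ^ 2"

fun polyline :: "pt list \<Rightarrow> real \<Rightarrow> pt" where
  "polyline [] = linepath 0 0"
| "polyline [a] = linepath a a"
| "polyline [a, b] = linepath a b"
| "polyline (a # b # c # rest) = linepath a b +++ polyline (b # c # rest)"

definition closed_polyline :: "pt list \<Rightarrow> real \<Rightarrow> pt" where
  "closed_polyline ps = polyline (ps @ [hd ps])"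

definition polyregion :: "pt list \<Rightarrow> pt set" where
  "polyregion ps = path_image (closed_polyline ps) \<union> inside (path_image (closed_polyline ps))"

definition polygon :: "pt set \<Rightarrow> bool" where
  "polygon R \<longleftrightarrow> (\<exists>ps. length ps \<ge> 3 \<and> simple_path (closed_polyline ps) \<and> R = polyregion ps)"

text \<open>A quadrilateral (as an abstract 4-cycle) is represented by its set of edges;
  this determines the cyclic order of its vertices up to rotation and reflection.\<close>
definition cyc :: "'a \<Rightarrow> 'a \<Rightarrow> 'a \<Rightarrow> 'a \<Rightarrow> 'a set set" where
  "cyc a b c d = {{a, b}, {b, c}, {c, d}, {d, a}}"

definition good_quad :: "pt \<Rightarrow> pt \<Rightarrow> pt \<Rightarrow> pt \<Rightarrow> bool" where
  "good_quad a b c d \<longleftrightarrow> simple_path (closed_polyline [a, b, c, d])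
     \<and> \<not> collinear {a, b, c} \<and> \<not> collinear {b, c, d} \<and> \<not> collinear {c, d, a} \<and> \<not> collinear {d, a, b}"

definition is_quad :: "pt set set \<Rightarrow> bool" where
  "is_quad E \<longleftrightarrow> (\<exists>a b c d. E = cyc a b c d \<and> good_quad a b c d)"

definition qregion :: "pt set set \<Rightarrow> pt set" where
  "qregion E = \<Union>{polyregion [a, b, c, d] | a b c d. E = cyc a b c d}"

definition qverts :: "'a set set \<Rightarrow> 'a set" where
  "qverts E = \<Union>E"

definition quadrangulation :: "pt set \<Rightarrow> pt set set set \<Rightarrow> bool" where
  "quadrangulation R T \<longleftrightarrow> finite T \<and> (\<forall>E\<in>T. is_quad E) \<and> \<Union>(qregion ` T) = R
     \<and> (\<forall>E1\<in>T. \<forall>E2\<in>T. E1 \<noteq> E2 \<longrightarrow>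
          qregion E1 \<inter> qregion E2 = {}
        \<or> (\<exists>p \<in> qverts E1 \<inter> qverts E2. qregion E1 \<inter> qregion E2 = {p})
        \<or> (\<exists>p q. {p, q} \<in> E1 \<inter> E2 \<and> qregion E1 \<inter> qregion E2 = closed_segment p q))"

definition flip :: "pt set set set \<Rightarrow> pt set set set \<Rightarrow> pt \<Rightarrow> (nat \<Rightarrow> pt) \<Rightarrow> pt \<Rightarrow> bool" where
  "flip T T' w h v \<longleftrightarrow>
     cyc w (h 1) (h 2) (h 3) \<in> T \<and> cyc w (h 3) (h 4) (h 5) \<in> T \<and> cyc w (h 5) (h 6) (h 1) \<in> T
   \<and> (\<forall>E\<in>T. w \<in> qverts E \<longrightarrow> E \<in> {cyc w (h 1) (h 2) (h 3), cyc w (h 3) (h 4) (h 5), cyc w (h 5) (h 6) (h 1)})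
   \<and> w \<in> interior (\<Union>(qregion ` T))
   \<and> T' = (T - {cyc w (h 1) (h 2) (h 3), cyc w (h 3) (h 4) (h 5), cyc w (h 5) (h 6) (h 1)})
           \<union> {cyc v (h 2) (h 3) (h 4), cyc v (h 4) (h 5) (h 6), cyc v (h 6) (h 1) (h 2)}"

definition pile :: "(nat \<Rightarrow> pt set set set) \<Rightarrow> nat \<Rightarrow> (nat \<Rightarrow> pt) \<Rightarrow> (nat \<Rightarrow> nat \<Rightarrow> pt) \<Rightarrow> (nat \<Rightarrow> pt) \<Rightarrow> bool" where
  "pile Ts l fw fh fv \<longleftrightarrow>
     (\<exists>R. polygon R \<and> (\<forall>i\<le>l. quadrangulation R (Ts i)))
   \<and> (\<forall>i\<in>{1..l}. flip (Ts (i - 1)) (Ts i) (fw i) (fh i) (fv i))"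

text \<open>Vertices of kappa: (p, 0) for vertices p of T_0, and (v_i, i) for the new vertex of flip i.
  The vertex of kappa sitting at the point p of T_i is the most recently created one.\<close>
type_synonym kv = "pt \<times> nat"

fun vlab :: "(nat \<Rightarrow> pt) \<Rightarrow> nat \<Rightarrow> pt \<Rightarrow> kv" where
  "vlab fv 0 p = (p, 0)"
| "vlab fv (Suc i) p = (if p = fv (Suc i) then (p, Suc i) else vlab fv i p)"

definition lab_face :: "(nat \<Rightarrow> pt) \<Rightarrow> nat \<Rightarrow> pt set set \<Rightarrow> kv set set" where
  "lab_face fv i E = (\<lambda>e. vlab fv i ` e) ` E"

definition kverts :: "(nat \<Rightarrow> pt set set set) \<Rightarrow> nat \<Rightarrow> (nat \<Rightarrow> pt) \<Rightarrow> kv set" where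
  "kverts Ts l fv = {(p, 0) | p. p \<in> \<Union>(qverts ` Ts 0)} \<union> {(fv i, i) | i. i \<in> {1..l}}"

definition kfaces :: "(nat \<Rightarrow> pt set set set) \<Rightarrow> nat \<Rightarrow> (nat \<Rightarrow> nat \<Rightarrow> pt) \<Rightarrow> (nat \<Rightarrow> pt) \<Rightarrow> kv set set set" where
  "kfaces Ts l fh fv = lab_face fv 0 ` Ts 0
     \<union> (\<Union>i\<in>{1..l}. lab_face fv i ` {cyc (fv i) (fh i 2) (fh i 3) (fh i 4),
                                       cyc (fv i) (fh i 4) (fh i 5) (fh i 6),
                                       cyc (fv i) (fh i 6) (fh i 1) (fh i 2)})"

definition kcube :: "(nat \<Rightarrow> pt) \<Rightarrow> (nat \<Rightarrow> nat \<Rightarrow> pt) \<Rightarrow> (nat \<Rightarrow> pt) \<Rightarrow> nat \<Rightarrow> bool \<Rightarrow> bool \<Rightarrow> bool \<Rightarrow> kv" where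
  "kcube fw fh fv i a b c =
     (if a \<and> b \<and> c then (fv i, i)
      else vlab fv (i - 1)
        (if \<not> a \<and> \<not> b \<and> \<not> c then fw i
         else if a \<and> \<not> b \<and> \<not> c then fh i 1
         else if a \<and> b \<and> \<not> c then fh i 2
         else if \<not> a \<and> b \<and> \<not> c then fh i 3
         else if \<not> a \<and> b \<and> c then fh i 4
         else if \<not> a \<and> \<not> b \<and> c then fh i 5
         else fh i 6))"

definition corners :: "(bool \<Rightarrow> bool \<Rightarrow> bool \<Rightarrow> 'a) \<Rightarrow> 'a set" where
  "corners g = {g a b c | a b c. True}"

definition face_x :: "(bool \<Rightarrow> bool \<Rightarrow> bool \<Rightarrow> 'a) \<Rightarrow> bool \<Rightarrow> 'a set set" where
  "face_x g b = cyc (g b False False) (g b True False) (g b True True) (g b False True)"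
definition face_y :: "(bool \<Rightarrow> bool \<Rightarrow> bool \<Rightarrow> 'a) \<Rightarrow> bool \<Rightarrow> 'a set set" where
  "face_y g b = cyc (g False b False) (g True b False) (g True b True) (g False b True)"
definition face_z :: "(bool \<Rightarrow> bool \<Rightarrow> bool \<Rightarrow> 'a) \<Rightarrow> bool \<Rightarrow> 'a set set" where
  "face_z g b = cyc (g False False b) (g True False b) (g True True b) (g False True b)"

text \<open>Points of the realization are weight functions on vertices (multilinear coordinates);
  the realization carries the subspace topology of the product topology.\<close>
definition wt :: "bool \<Rightarrow> real \<Rightarrow> real" where
  "wt b s = (if b then s else 1 - s)"

definition sqpt :: "'a \<Rightarrow> 'a \<Rightarrow> 'a \<Rightarrow> 'a \<Rightarrow> real \<Rightarrow> real \<Rightarrow> 'a \<Rightarrow> real" where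
  "sqpt a b c d s t = (\<lambda>u. (if u = a then (1 - s) * (1 - t) else 0) + (if u = b then s * (1 - t) else 0)
                         + (if u = c then s * t else 0) + (if u = d then (1 - s) * t else 0))"

definition cubept :: "(bool \<Rightarrow> bool \<Rightarrow> bool \<Rightarrow> 'a) \<Rightarrow> real \<Rightarrow> real \<Rightarrow> real \<Rightarrow> 'a \<Rightarrow> real" where
  "cubept g x y z = (\<lambda>u. \<Sum>p\<in>(UNIV :: (bool \<times> bool \<times> bool) set).
       (case p of (i, j, k) \<Rightarrow> if g i j k = u then wt i x * wt j y * wt k z else 0))"

definition realization :: "(nat \<Rightarrow> pt set set set) \<Rightarrow> nat \<Rightarrow> (nat \<Rightarrow> pt) \<Rightarrow> (nat \<Rightarrow> nat \<Rightarrow> pt) \<Rightarrow> (nat \<Rightarrow> pt) \<Rightarrow> (kv \<Rightarrow> real) set" where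
  "realization Ts l fw fh fv =
     (\<Union>F\<in>kfaces Ts l fh fv. {sqpt a b c d s t | a b c d s t. F = cyc a b c d \<and> s \<in> {0..1} \<and> t \<in> {0..1}})
   \<union> (\<Union>i\<in>{1..l}. {cubept (kcube fw fh fv i) x y z | x y z. x \<in> {0..1} \<and> y \<in> {0..1} \<and> z \<in> {0..1}})"

definition interior_vertex :: "(nat \<Rightarrow> pt set set set) \<Rightarrow> nat \<Rightarrow> (nat \<Rightarrow> pt) \<Rightarrow> (nat \<Rightarrow> nat \<Rightarrow> pt) \<Rightarrow> (nat \<Rightarrow> pt) \<Rightarrow> kv \<Rightarrow> bool" where
  "interior_vertex Ts l fw fh fv v \<longleftrightarrow> v \<in> kverts Ts l fv \<and>
     (\<exists>U. openin (top_of_set (realization Ts l fw fh fv)) U \<and> (\<lambda>u. if u = v then 1 else 0) \<in> U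
        \<and> (\<exists>(c :: real ^ 3) r. r > 0 \<and> U homeomorphic ball c r))"

definition opp_faces :: "(nat \<Rightarrow> pt) \<Rightarrow> (nat \<Rightarrow> nat \<Rightarrow> pt) \<Rightarrow> (nat \<Rightarrow> pt) \<Rightarrow> nat \<Rightarrow> kv set set \<Rightarrow> kv set set \<Rightarrow> bool" where
  "opp_faces fw fh fv l s s' \<longleftrightarrow> (\<exists>i\<in>{1..l}. let g = kcube fw fh fv i in
      (s = face_x g False \<and> s' = face_x g True) \<or> (s = face_y g False \<and> s' = face_y g True)
    \<or> (s = face_z g False \<and> s' = face_z g True))"

definition fclass :: "(nat \<Rightarrow> pt) \<Rightarrow> (nat \<Rightarrow> nat \<Rightarrow> pt) \<Rightarrow> (nat \<Rightarrow> pt) \<Rightarrow> nat \<Rightarrow> kv set set \<Rightarrow> kv set set set" where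
  "fclass fw fh fv l s = {s'. equivclp (opp_faces fw fh fv l) s s'}"

definition psi :: "(nat \<Rightarrow> pt) \<Rightarrow> (nat \<Rightarrow> nat \<Rightarrow> pt) \<Rightarrow> (nat \<Rightarrow> pt) \<Rightarrow> nat \<Rightarrow> (kv set set set \<Rightarrow> int) \<Rightarrow> nat \<Rightarrow> int" where
  "psi fw fh fv l t i = (let g = kcube fw fh fv i in
      t (fclass fw fh fv l (face_x g False)) * t (fclass fw fh fv l (face_y g False))
    * t (fclass fw fh fv l (face_z g False)))"

definition cubes_at :: "(nat \<Rightarrow> pt) \<Rightarrow> (nat \<Rightarrow> nat \<Rightarrow> pt) \<Rightarrow> (nat \<Rightarrow> pt) \<Rightarrow> nat \<Rightarrow> kv \<Rightarrow> nat set" where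
  "cubes_at fw fh fv l v = {i \<in> {1..l}. v \<in> corners (kcube fw fh fv i)}"

definition comfortable :: "(nat \<Rightarrow> pt set set set) \<Rightarrow> nat \<Rightarrow> (nat \<Rightarrow> pt) \<Rightarrow> (nat \<Rightarrow> nat \<Rightarrow> pt) \<Rightarrow> (nat \<Rightarrow> pt) \<Rightarrow> bool" where
  "comfortable Ts l fw fh fv \<longleftrightarrow>
     (\<forall>u :: nat \<Rightarrow> int. (\<forall>i\<in>{1..l}. u i \<in> {-1, 1})
        \<and> (\<forall>v. interior_vertex Ts l fw fh fv v \<longrightarrow> (\<Prod>i\<in>cubes_at fw fh fv l v. u i) = 1)
      \<longrightarrow> (\<exists>t :: kv set set set \<Rightarrow> int.
             (\<forall>C\<in>fclass fw fh fv l ` kfaces Ts l fh fv. t C \<in> {-1, 1})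
           \<and> (\<forall>i\<in>{1..l}. u i = psi fw fh fv l t i)))"

definition KC :: "(bool \<Rightarrow> bool \<Rightarrow> bool \<Rightarrow> 'a) \<Rightarrow> ('a \<Rightarrow> complex) \<Rightarrow> complex" where
  "KC g x = (let z = (\<lambda>i j k. x (g i j k));
      a = z False False False * z True True True;
      b = z True False False * z False True True;
      c = z False True False * z True False True;
      d = z False False True * z True True False;
      s = z False False False * z False True True * z True False True * z True True False;
      t = z True True True * z True False False * z False True False * z False False True
    in 2 * (a\<^sup>2 + b\<^sup>2 + c\<^sup>2 + d\<^sup>2) - (a + b + c + d)\<^sup>2 - 4 * (s + t))"

definition KC0 :: "(bool \<Rightarrow> bool \<Rightarrow> bool \<Rightarrow> 'a) \<Rightarrow> ('a \<Rightarrow> complex) \<Rightarrow> complex" where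
  "KC0 g x = (let z = (\<lambda>i j k. x (g i j k)) in
      (z True True True * (z False False False)\<^sup>2
        - z False False False * (z True False False * z False True True + z False True False * z True False True
                                 + z False False True * z True True False)) / 2
      - z True False False * z False True False * z False False True)"

text \<open>K^C_v for an arbitrary vertex v of C: relabel the cube so that v becomes 000.\<close>
definition KCv :: "(bool \<Rightarrow> bool \<Rightarrow> bool \<Rightarrow> 'a) \<Rightarrow> 'a \<Rightarrow> ('a \<Rightarrow> complex) \<Rightarrow> complex" where
  "KCv g v x = (case (SOME p. (case p of (a, b, c) \<Rightarrow> g a b c = v)) of (a, b, c) \<Rightarrow>
      KC0 (\<lambda>i j k. g (i \<noteq> a) (j \<noteq> b) (k \<noteq> c)) x)"

definition face_term :: "('a \<Rightarrow> complex) \<Rightarrow> 'a \<Rightarrow> 'a set set \<Rightarrow> complex" where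
  "face_term x v S = (SOME r. \<exists>v1 v2 v3. S = cyc v v1 v2 v3 \<and> r = x v * x v2 + x v1 * x v3)"

definition coherent_kashaev :: "(nat \<Rightarrow> pt set set set) \<Rightarrow> nat \<Rightarrow> (nat \<Rightarrow> pt) \<Rightarrow> (nat \<Rightarrow> nat \<Rightarrow> pt) \<Rightarrow> (nat \<Rightarrow> pt) \<Rightarrow> (kv \<Rightarrow> complex) \<Rightarrow> bool" where
  "coherent_kashaev Ts l fw fh fv x \<longleftrightarrow>
     (\<forall>i\<in>{1..l}. KC (kcube fw fh fv i) x = 0)
   \<and> (\<forall>v. interior_vertex Ts l fw fh fv v \<longrightarrow>
        (\<Prod>i\<in>cubes_at fw fh fv l v. KCv (kcube fw fh fv i) v x)
      = (\<Prod>S\<in>{S \<in> kfaces Ts l fh fv. v \<in> \<Union>S}. face_term x v S))"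

definition khex_cube :: "(bool \<Rightarrow> bool \<Rightarrow> bool \<Rightarrow> 'a) \<Rightarrow> ('a \<Rightarrow> complex) \<Rightarrow> ('a set set \<Rightarrow> complex) \<Rightarrow> bool" where
  "khex_cube g x y \<longleftrightarrow> (let z = (\<lambda>i j k. x (g i j k));
      X0 = y (face_x g False); X1 = y (face_x g True);
      Y0 = y (face_y g False); Y1 = y (face_y g True);
      Z0 = y (face_z g False); Z1 = y (face_z g True);
      A = 2 * z True False False * z False True False * z False False True
          + z False False False * (z True False False * z False True True + z False True False * z True False True
                                   + z False False True * z True True False)
    in X1 = (Y0 * Z0 + X0 * z True False False) / z False False False
     \<and> Y1 = (X0 * Z0 + Y0 * z False True False) / z False False False
     \<and> Z1 = (X0 * Y0 + Z0 * z False False True) / z False False False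
     \<and> z True True True = (A + 2 * X0 * Y0 * Z0) / (z False False False)\<^sup>2)"

definition khexahedron :: "(nat \<Rightarrow> pt set set set) \<Rightarrow> nat \<Rightarrow> (nat \<Rightarrow> pt) \<Rightarrow> (nat \<Rightarrow> nat \<Rightarrow> pt) \<Rightarrow> (nat \<Rightarrow> pt) \<Rightarrow> (kv \<Rightarrow> complex) \<Rightarrow> (kv set set \<Rightarrow> complex) \<Rightarrow> bool" where
  "khexahedron Ts l fw fh fv x y \<longleftrightarrow>
     (\<forall>v\<in>kverts Ts l fv. x v \<noteq> 0)
   \<and> (\<forall>S\<in>kfaces Ts l fh fv. \<forall>v1 v2 v3 v4. S = cyc v1 v2 v3 v4 \<longrightarrow> (y S)\<^sup>2 = x v1 * x v3 + x v2 * x v4)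
   \<and> (\<forall>i\<in>{1..l}. khex_cube (kcube fw fh fv i) x y)"

end

(* Take arbitrary square roots for the face values on T_0 and propagate them upwards. The Kashaev equation
   forces each cube C to satisfy the K-hexahedron equations up to a sign u_C, and then for every vertex v
   of C the quantity K^C_v is u_C times the product of the three face values at v, up to a further sign which
   is +1 at the bottom and top vertex and -1 at the other six. If v is interior, invariance of domain shows
   that every face at v lies in two cubes, so the face values multiply to the squares on the right of the
   coherence equation, the number of cubes at v is even, and exactly two of them have v as bottom or top.
   Coherence thus says that the u_C at v multiply to 1. Comfort writes u as psi(t), and multiplying the value
   of each face s by the sign of its class in t turns all u_C into 1.
   For the face to be in at most two cubes one needs that the vertex created by a flip is a vertex of no other
   quadrilateral; in the plane, three quadrilaterals sharing edges cyclically around v fill a neighbourhood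
   of v. *)
theory Submission
  imports Defs
begin

section \<open>Abstract quadrilaterals\<close>

text \<open>The sign of a cube comes from a polynomial identity: when \<open>KC\<close> vanishes,
  the square of \<open>KC0\<close> is the product of the three face terms at the bottom vertex. So
  above \<open>Ts 0\<close> nothing is chosen, and nonvanishing face terms permit the division that
  defines the sign. Counting the cubes at a face rests on time. A vertex of the complex carries the
  index of the flip that created it, and a label removed by a flip never returns; hence a face is an
  upper face of at most one cube and a lower face of at most one, later, cube. The topological
  obstacle is that \<open>interior_vertex\<close> gives only an abstract homeomorphism of a set of
  weight functions. A point of the face near \<open>v\<close> is needed whose neighbourhood meets no
  cells but that face and the cubes bounded by it. A square on the same four vertices in another
  cyclic order could meet the face, so the point is taken where the weight of \<open>v\<close>
  dominates. With fewer than two cubes the complex embeds near this point into a closed half-space,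
  with the point on the boundary plane. The two exceptional cubes at an interior vertex are the one
  that creates it and the last one containing it.\<close>

lemma cyc_Union [simp]: "\<Union>(cyc a b c d) = {a, b, c, d}"
  by (auto simp: cyc_def)

lemma cyc_rotate: "cyc a b c d = cyc b c d a"
  by (auto simp: cyc_def)

lemma cyc_reverse: "cyc a b c d = cyc a d c b"
  by (auto simp: cyc_def insert_commute)

text \<open>The edges at \<open>a\<close> determine its two neighbours, and the remaining vertex is
  opposite; only the direction of travel stays free.\<close>

lemma cyc_eq_first:
  assumes d: "distinct [a, b, c, d]" and E: "cyc a b c d = cyc a q r s"
  shows "(q, r, s) \<in> {(b, c, d), (d, c, b)}"
proof -
  have U: "{a, q, r, s} = {a, b, c, d}" using arg_cong[OF E, of Union] by simp
  then have "card {a, q, r, s} = 4" using d by simp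
  then have d': "distinct [a, q, r, s]" using card_distinct[of "[a, q, r, s]"] by simp
  have "{a, q} \<in> cyc a b c d" "{s, a} \<in> cyc a b c d" unfolding E by (simp_all add: cyc_def)
  then have "q \<in> {b, d}" "s \<in> {b, d}" using d d' by (auto simp: cyc_def doubleton_eq_iff)
  then show ?thesis using U d d' by auto
qed

text \<open>The eight tuples are the orbit of \<open>(a, b, c, d)\<close> under the dihedral group
  of the square.\<close>

lemma cyc_eqD:
  assumes d: "distinct [a, b, c, d]" and E: "cyc a b c d = cyc p q r s"
  shows "(p, q, r, s) \<in> {(a,b,c,d), (b,c,d,a), (c,d,a,b), (d,a,b,c), (d,c,b,a), (c,b,a,d), (b,a,d,c), (a,d,c,b)}"
proof -
  have r: "cyc b c d a = cyc p q r s" "cyc c d a b = cyc p q r s" "cyc d a b c = cyc p q r s"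
    using E by (metis cyc_rotate)+
  have d': "distinct [b, c, d, a]" "distinct [c, d, a, b]" "distinct [d, a, b, c]" using d by auto
  have "p \<in> {a, b, c, d}" using arg_cong[OF E, of Union] by auto
  then consider "p = a" | "p = b" | "p = c" | "p = d" by blast
  then show ?thesis
  proof cases
    case 1
    show ?thesis using cyc_eq_first[OF d E[unfolded 1]] unfolding 1 by (elim insertE emptyE) simp_all
  next
    case 2
    show ?thesis using cyc_eq_first[OF d'(1) r(1)[unfolded 2]] unfolding 2 by (elim insertE emptyE) simp_all
  next
    case 3
    show ?thesis using cyc_eq_first[OF d'(2) r(2)[unfolded 3]] unfolding 3 by (elim insertE emptyE) simp_all
  next
    case 4
    show ?thesis using cyc_eq_first[OF d'(3) r(3)[unfolded 4]] unfolding 4 by (elim insertE emptyE) simp_all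
  qed
qed

section \<open>Quadrilaterals in the plane\<close>

text \<open>Built from the edge set alone, so that no cyclic reading has to be chosen.\<close>

definition quad_bd :: "pt set set \<Rightarrow> pt set" where
  "quad_bd E = (\<Union>e\<in>E. convex hull e)"

definition quad_int :: "pt set set \<Rightarrow> pt set" where
  "quad_int E = inside (quad_bd E)"

lemma quad_bd_cyc: "quad_bd (cyc a b c d) =
    closed_segment a b \<union> closed_segment b c \<union> closed_segment c d \<union> closed_segment d a"
  by (auto simp: quad_bd_def cyc_def segment_convex_hull)

lemma path_image_closed_polyline: "path_image (closed_polyline [a, b, c, d]) = quad_bd (cyc a b c d)"
  by (auto simp: closed_polyline_def path_image_join quad_bd_cyc)

text \<open>\<open>is_quad\<close> hides its cyclic reading under an existential quantifier. These
  consequences of \<open>good_quad\<close> are visibly invariant under all eight relabellings, so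
  they pass to any reading.\<close>

definition quad_conds :: "pt \<Rightarrow> pt \<Rightarrow> pt \<Rightarrow> pt \<Rightarrow> bool" where
  "quad_conds a b c d \<longleftrightarrow> distinct [a, b, c, d] \<and>
     \<not> collinear {a, b, c} \<and> \<not> collinear {b, c, d} \<and> \<not> collinear {c, d, a} \<and> \<not> collinear {d, a, b} \<and>
     closed_segment a b \<inter> closed_segment c d = {} \<and> closed_segment b c \<inter> closed_segment d a = {}"

lemma good_quad_conds:
  assumes "good_quad a b c d"
  shows "quad_conds a b c d"
proof -
  have "simple_path (linepath a b +++ (linepath b c +++ (linepath c d +++ linepath d a)))"
    using assms by (simp add: good_quad_def closed_polyline_def)
  then have *: "a \<noteq> b" "b \<noteq> c" "c \<noteq> d" "d \<noteq> a"
    "closed_segment a b \<inter> (closed_segment b c \<union> (closed_segment c d \<union> closed_segment d a)) \<subseteq> {a, b}"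
    "closed_segment b c \<inter> (closed_segment c d \<union> closed_segment d a) \<subseteq> {c}"
    "closed_segment c d \<inter> closed_segment d a \<subseteq> {d}"
    by (auto simp: simple_path_join_loop_eq arc_join_eq path_image_join dest: arc_distinct_ends)
  have "a \<notin> closed_segment c d" "b \<notin> closed_segment c d" "c \<notin> closed_segment d a"
    using *(1-4) *(6,7) ends_in_segment[of a d] ends_in_segment[of b c] ends_in_segment[of c d] ends_in_segment[of d a]
    by blast+
  then have d: "closed_segment a b \<inter> closed_segment c d = {}" "closed_segment b c \<inter> closed_segment d a = {}"
    using * by blast+
  then have "distinct [a, b, c, d]" using * by auto
  then show ?thesis using d assms by (simp add: quad_conds_def good_quad_def)
qed

lemma is_quad_conds:
  assumes "is_quad (cyc a b c d)"
  shows "quad_conds a b c d"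
proof -
  obtain p q r s where E: "cyc p q r s = cyc a b c d" and g: "quad_conds p q r s"
    using assms good_quad_conds by (metis is_quad_def)
  then have "(a, b, c, d) \<in> {(p,q,r,s), (q,r,s,p), (r,s,p,q), (s,p,q,r), (s,r,q,p), (r,q,p,s), (q,p,s,r), (p,s,r,q)}"
    using g by (intro cyc_eqD[OF _ E]) (simp add: quad_conds_def)
  then show ?thesis
    using g unfolding quad_conds_def
    by (elim insertE) (simp_all add: insert_commute Int_commute closed_segment_commute, blast+)
qed

lemma qregion_eq:
  assumes "is_quad E"
  shows "qregion E = quad_bd E \<union> quad_int E"
proof -
  have "qregion E = \<Union>{quad_bd E \<union> quad_int E | a b c d. E = cyc a b c d}"
    unfolding qregion_def polyregion_def path_image_closed_polyline quad_int_def
    by (rule arg_cong[where f = Union]) auto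
  moreover obtain a b c d where "E = cyc a b c d" using assms by (auto simp: is_quad_def)
  ultimately show ?thesis by blast
qed

text \<open>The Jordan curve theorem: two complementary components cannot both be unbounded, so a
  bounded one exists, and its frontier is already the whole curve.\<close>

lemma frontier_quad_int:
  assumes "is_quad E"
  shows "frontier (quad_int E) = quad_bd E"
proof -
  obtain a b c d where E: "E = cyc a b c d" and g: "simple_path (closed_polyline [a, b, c, d])"
    using assms by (auto simp: is_quad_def good_quad_def)
  define P where "P = quad_bd E"
  have P: "P = path_image (closed_polyline [a, b, c, d])"
    by (simp add: P_def E path_image_closed_polyline)
  have cP: "compact P" "closed P"
    using g P compact_simple_path_image compact_imp_closed by auto
  have "P homeomorphic sphere (0 :: complex) 1"
    unfolding P using g by (intro homeomorphic_simple_path_image_circle) (auto simp: closed_polyline_def)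
  moreover have "sphere (0 :: complex) 1 homeomorphic sphere (0 :: pt) 1"
    by (rule homeomorphic_spheres_gen) auto
  ultimately have S: "P homeomorphic sphere (0 :: pt) 1"
    by (rule homeomorphic_trans)
  have "\<not> connected (- P)"
    using Jordan_Brouwer_separation[OF S] by simp
  then obtain C1 C2 where C: "C1 \<in> components (- P)" "C2 \<in> components (- P)" "C1 \<noteq> C2"
    by (auto simp: connected_eq_connected_components_eq)
  have "bounded C1 \<or> bounded C2"
    using cobounded_unique_unbounded_components[of "- P" C1 C2] C cP compact_imp_bounded by auto
  then obtain C where CC: "C \<in> components (- P)" "bounded C" using C by blast
  have "C \<subseteq> inside P"
  proof
    fix x assume "x \<in> C"
    obtain z where z: "C = connected_component_set (- P) z" using CC(1) by (auto simp: components_iff)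
    then have "C = connected_component_set (- P) x" "x \<in> - P"
      using \<open>x \<in> C\<close> connected_component_eq[of x "- P" z] connected_component_in[of "- P" z x] by auto
    then show "x \<in> inside P" using CC by (simp add: inside_def)
  qed
  moreover have "frontier C = P"
    using Jordan_Brouwer_frontier[OF S CC(1)] by simp
  ultimately have "P \<subseteq> closure (inside P)"
    by (metis closure_mono frontier_def Diff_subset order_trans)
  moreover have "P \<inter> inside P = {}" using inside_no_overlap[of P] by blast
  moreover have "open (inside P)" using cP open_inside by blast
  ultimately have "P \<subseteq> frontier (inside P)"
    by (auto simp: frontier_def interior_open)
  moreover have "frontier (inside P) \<subseteq> P" using cP frontier_inside_subset by blast
  ultimately show ?thesis unfolding P_def quad_int_def by blast
qed

lemma open_quad_int:
  assumes "is_quad E"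
  shows "open (quad_int E)"
proof -
  have "closed (quad_bd E)" using frontier_quad_int[OF assms] frontier_closed by metis
  then show ?thesis by (simp add: quad_int_def open_inside)
qed

lemma qregion_closure:
  assumes "is_quad E"
  shows "qregion E = closure (quad_int E)"
  using qregion_eq[OF assms] frontier_quad_int[OF assms] closure_Un_frontier[of "quad_int E"] by auto

lemma edge_first:
  assumes "E = cyc p q r s" "{a, b} \<in> E"
  obtains c d where "E = cyc a b c d"
proof -
  have "{a, b} \<in> {{p, q}, {q, r}, {r, s}, {s, p}}" using assms by (simp add: cyc_def)
  then consider "a = p" "b = q" | "a = q" "b = p" | "a = q" "b = r" | "a = r" "b = q"
    | "a = r" "b = s" | "a = s" "b = r" | "a = s" "b = p" | "a = p" "b = s"
    by (auto simp: doubleton_eq_iff)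
  then show thesis
    using that[of r s] that[of s r] that[of s p] that[of p s] that[of p q] that[of q p] that[of q r] that[of r q]
    by cases (auto simp: assms(1) cyc_def insert_commute)
qed

text \<open>The two adjacent edges meet the edge only in its endpoints by noncollinearity; the
  opposite one is disjoint from it.\<close>

lemma open_segment_other_edges:
  assumes "is_quad E" "{a, b} \<in> E" "m \<in> open_segment a b" "e \<in> E" "e \<noteq> {a, b}"
  shows "m \<notin> convex hull e"
proof -
  obtain c d where E: "E = cyc a b c d"
    using assms edge_first by (metis is_quad_def)
  then have g: "quad_conds a b c d" using assms is_quad_conds by blast
  have "closed_segment a b \<inter> closed_segment b c = {b}" "closed_segment d a \<inter> closed_segment a b = {a}"
    using g by (auto intro!: Int_closed_segment simp: quad_conds_def)
  moreover have "closed_segment a b \<inter> closed_segment c d = {}" using g by (auto simp: quad_conds_def)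
  moreover have "m \<in> closed_segment a b" "m \<noteq> a" "m \<noteq> b" using assms by (auto simp: open_segment_def)
  ultimately have "m \<notin> closed_segment b c" "m \<notin> closed_segment c d" "m \<notin> closed_segment d a" by blast+
  moreover have "e \<in> {{b, c}, {c, d}, {d, a}}" using assms(4,5) unfolding E cyc_def by blast
  ultimately show ?thesis by (elim insertE) (simp_all add: segment_convex_hull)
qed

lemma finite_quad: "is_quad E \<Longrightarrow> finite E"
  by (auto simp: is_quad_def cyc_def)

lemma finite_edge: "is_quad E \<Longrightarrow> e \<in> E \<Longrightarrow> finite e"
  by (auto simp: is_quad_def cyc_def)

lemma closed_edges:
  assumes "is_quad E" "F \<subseteq> E"
  shows "closed (\<Union>e\<in>F. convex hull e)"
proof (rule closed_UN)
  show "finite F" using assms finite_quad finite_subset by blast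
  show "\<forall>e\<in>F. closed (convex hull e)"
    using assms finite_edge finite_imp_compact_convex_hull compact_imp_closed by blast
qed

text \<open>Each side of the line through a small disc around m is connected and misses the boundary
  of both quadrilaterals, so it lies in or out of either of them.\<close>
lemma common_edge_interior:
  assumes E1: "is_quad E1" "{a, b} \<in> E1" and E2: "is_quad E2" "{a, b} \<in> E2"
    and disj: "quad_int E1 \<inter> quad_int E2 = {}" and m: "m \<in> open_segment a b"
  shows "m \<in> interior (qregion E1 \<union> qregion E2)"
proof -
  \<comment> \<open>All edges except the common one. Off \<open>K\<close>, a disc around
    \<open>m\<close> meets the two boundaries only along the line through \<open>a\<close> and
    \<open>b\<close>.\<close>
  define K where "K = (\<Union>e\<in>E1 - {{a, b}}. convex hull e) \<union> (\<Union>e\<in>E2 - {{a, b}}. convex hull e)"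
  have "closed K" unfolding K_def using closed_edges E1 E2 by (intro closed_Un) auto
  moreover have "m \<notin> K" using open_segment_other_edges E1 E2 m by (auto simp: K_def)
  ultimately obtain r where r: "r > 0" "ball m r \<inter> K = {}"
    by (metis Compl_iff disjoint_eq_subset_Compl open_Compl open_contains_ball)
  define B where "B = ball m r"
  \<comment> \<open>The vector \<open>b - a\<close> turned by a right angle, a normal of the
    line.\<close>
  define n :: pt where "n = (\<chi> i. if i = 1 then - (b - a) $ 2 else (b - a) $ 1)"
  have ne: "a \<noteq> b" using m by auto
  have mab: "m \<in> convex hull {a, b}"
    using m by (simp add: open_segment_def segment_convex_hull)
  have n0: "n \<noteq> 0"
    using ne by (auto simp: n_def vec_eq_iff forall_2)
  have nab: "n \<bullet> b = n \<bullet> a" by (simp add: n_def inner_vec_def sum_2 algebra_simps)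
  have seg: "n \<bullet> p = n \<bullet> a" if "p \<in> convex hull {a, b}" for p
  proof -
    have "p \<in> closed_segment a b" using that by (simp only: segment_convex_hull)
    then obtain u where "p = (1 - u) *\<^sub>R a + u *\<^sub>R b" by (auto simp: closed_segment_def)
    then have "n \<bullet> p = (1 - u) * (n \<bullet> a) + u * (n \<bullet> b)" by (simp add: inner_right_distrib)
    then show ?thesis using nab by (simp add: algebra_simps)
  qed
  define L where "L = B \<inter> {p. n \<bullet> p < n \<bullet> a}"
  define G where "G = B \<inter> {p. n \<bullet> p > n \<bullet> a}"
  have con: "connected L" "connected G"
    unfolding L_def G_def B_def
    by (auto intro!: convex_connected convex_Int convex_halfspace_lt convex_halfspace_gt)
  have LGbd: "(L \<union> G) \<inter> quad_bd E = {}" if "E = E1 \<or> E = E2" for E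
  proof -
    have "quad_bd E \<subseteq> convex hull {a, b} \<union> K" using that by (auto simp: quad_bd_def K_def)
    then show ?thesis using r(2) seg by (fastforce simp: L_def G_def B_def)
  qed
  \<comment> \<open>The line has empty interior, so an open set near \<open>m\<close> always has
    points strictly on one side.\<close>
  have hyp: "interior {p. n \<bullet> p = n \<bullet> a} = {}" using n0 by (rule interior_hyperplane)
  have dich: "L \<subseteq> quad_int E \<or> G \<subseteq> quad_int E" if E: "E = E1 \<or> E = E2" for E
  proof -
    have q: "is_quad E" "{a, b} \<in> E" using E E1 E2 by auto
    have "m \<in> quad_bd E"
      using q(2) mab by (auto simp: quad_bd_def)
    then have "m \<in> closure (quad_int E)"
      using frontier_quad_int[OF q(1)] by (metis frontier_def DiffD1)
    then have "B \<inter> quad_int E \<noteq> {}"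
      using r(1) by (metis B_def closure_iff_nhds_not_empty centre_in_ball open_ball order_refl Int_commute)
    moreover have "open (B \<inter> quad_int E)" using open_quad_int[OF q(1)] by (auto simp: B_def)
    ultimately have "\<not> B \<inter> quad_int E \<subseteq> {p. n \<bullet> p = n \<bullet> a}"
      using hyp interior_maximal by blast
    then obtain p where "p \<in> B" "p \<in> quad_int E" "n \<bullet> p \<noteq> n \<bullet> a" by blast
    then have "p \<in> quad_int E" "p \<in> L \<union> G"
      by (auto simp: L_def G_def neq_iff)
    moreover have "C \<subseteq> quad_int E" if "connected C" "C \<subseteq> L \<union> G" "p \<in> C" "p \<in> quad_int E" for C
    proof (rule ccontr)
      assume "\<not> C \<subseteq> quad_int E"
      then have "C \<inter> frontier (quad_int E) \<noteq> {}"
        using that by (intro connected_Int_frontier) auto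
      then show False using LGbd[OF E] that frontier_quad_int[OF q(1)] by blast
    qed
    ultimately show ?thesis using con by blast
  qed
  \<comment> \<open>Each quadrilateral contains one of the two half-discs. As these are nonempty and
    the interiors disjoint, the quadrilaterals contain different ones.\<close>
  have "L \<noteq> {}" "G \<noteq> {}"
  proof -
    define \<epsilon> where "\<epsilon> = r / (2 * norm n)"
    have e: "\<epsilon> > 0" "\<epsilon> * norm n < r" using r(1) n0 by (auto simp: \<epsilon>_def)
    have "n \<bullet> m = n \<bullet> a" using mab by (rule seg)
    then have "m + \<epsilon> *\<^sub>R n \<in> G" "m - \<epsilon> *\<^sub>R n \<in> L"
      using e n0 by (auto simp: L_def G_def B_def dist_norm inner_right_distrib inner_diff_right)
    then show "L \<noteq> {}" "G \<noteq> {}" by auto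
  qed
  then have LG: "L \<union> G \<subseteq> quad_int E1 \<union> quad_int E2"
    using dich[OF disjI1[OF refl]] dich[OF disjI2[OF refl]] disj by (elim disjE) fast+
  have "B \<subseteq> closure (L \<union> G)"
  proof
    fix p assume p: "p \<in> B"
    show "p \<in> closure (L \<union> G)"
    proof (rule ccontr)
      assume "p \<notin> closure (L \<union> G)"
      then obtain U where U: "open U" "p \<in> U" "U \<inter> (L \<union> G) = {}"
        by (rule_tac that[of "- closure (L \<union> G)"]) (use closure_subset in auto)
      have "U \<inter> B \<subseteq> {p. n \<bullet> p = n \<bullet> a}"
      proof clarify
        fix q assume "q \<in> U" "q \<in> B"
        then have "\<not> n \<bullet> q < n \<bullet> a" "\<not> n \<bullet> q > n \<bullet> a" using U(3) by (auto simp: L_def G_def)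
        then show "n \<bullet> q = n \<bullet> a" by simp
      qed
      moreover have "open (U \<inter> B)" using U(1) by (simp add: B_def open_Int)
      ultimately have "U \<inter> B \<subseteq> {p. n \<bullet> p = n \<bullet> a}" "open (U \<inter> B)" by blast+
      then show False using hyp p U(2) interior_maximal by blast
    qed
  qed
  also have "\<dots> \<subseteq> closure (quad_int E1 \<union> quad_int E2)" using LG by (rule closure_mono)
  also have "\<dots> = qregion E1 \<union> qregion E2" using E1 E2 by (simp add: qregion_closure closure_Un)
  finally show ?thesis using r(1) by (auto simp: interior_def B_def)
qed

text \<open>The form in which face-to-face is applied: a segment has empty interior, which separates
  the interiors of the tiles, and it is collinear, which restricts their common vertices.\<close>

lemma quadrangulation_Int_segment:
  assumes "quadrangulation R T" "E1 \<in> T" "E2 \<in> T" "E1 \<noteq> E2"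
  obtains p q where "qregion E1 \<inter> qregion E2 \<subseteq> closed_segment p q"
proof -
  have "qregion E1 \<inter> qregion E2 = {}
        \<or> (\<exists>p. qregion E1 \<inter> qregion E2 = {p})
        \<or> (\<exists>p q. qregion E1 \<inter> qregion E2 = closed_segment p q)"
    using assms unfolding quadrangulation_def by (metis (no_types))
  then show thesis
    by (metis that ends_in_segment(1) insert_subset order_refl empty_subsetI)
qed

lemma quadrangulation_is_quad: "quadrangulation R T \<Longrightarrow> E \<in> T \<Longrightarrow> is_quad E"
  by (simp add: quadrangulation_def)

lemma quad_int_disjoint:
  assumes T: "quadrangulation R T" "E1 \<in> T" "E2 \<in> T" "E1 \<noteq> E2"
  shows "quad_int E1 \<inter> quad_int E2 = {}"
proof -
  have q: "is_quad E1" "is_quad E2" using T quadrangulation_is_quad by blast+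
  obtain p q where "qregion E1 \<inter> qregion E2 \<subseteq> closed_segment p q"
    using quadrangulation_Int_segment[OF T] .
  then have "quad_int E1 \<inter> quad_int E2 \<subseteq> closed_segment p q"
    using qregion_eq q by blast
  moreover have "open (quad_int E1 \<inter> quad_int E2)" using open_quad_int q by blast
  ultimately have "quad_int E1 \<inter> quad_int E2 \<subseteq> interior (closed_segment p q)"
    by (rule interior_maximal)
  then show ?thesis by (simp add: interior_closed_segment_ge2)
qed

lemma qverts_subset_quad_bd: "qverts E \<subseteq> quad_bd E"
  by (auto simp: qverts_def quad_bd_def intro: hull_inc)

lemma common_vertices_collinear:
  assumes T: "quadrangulation R T" "E1 \<in> T" "E2 \<in> T" "E1 \<noteq> E2"
    and V: "V \<subseteq> qverts E1" "V \<subseteq> qverts E2"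
  shows "collinear V"
proof -
  have q: "is_quad E1" "is_quad E2" using T quadrangulation_is_quad by blast+
  obtain p q where "qregion E1 \<inter> qregion E2 \<subseteq> closed_segment p q"
    using quadrangulation_Int_segment[OF T] .
  then have "V \<subseteq> closed_segment p q"
    using V qverts_subset_quad_bd qregion_eq q by blast
  then show ?thesis using collinear_closed_segment collinear_subset by blast
qed

text \<open>Within a small disc punctured at v, the union of the three quadrilaterals is closed,
  and open because each edge at v is shared by two of them.\<close>
lemma surrounded_vertex:
  assumes T: "quadrangulation R T"
    and E1: "cyc v a p b \<in> T" and E2: "cyc v b q c \<in> T" and E3: "cyc v c r a \<in> T"
    and ne: "cyc v a p b \<noteq> cyc v b q c" "cyc v b q c \<noteq> cyc v c r a" "cyc v a p b \<noteq> cyc v c r a"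
    and F: "F \<in> T" "v \<in> qverts F"
  shows "F \<in> {cyc v a p b, cyc v b q c, cyc v c r a}"
proof (rule ccontr)
  assume nF: "F \<notin> {cyc v a p b, cyc v b q c, cyc v c r a}"
  let ?E1 = "cyc v a p b" and ?E2 = "cyc v b q c" and ?E3 = "cyc v c r a"
  have q: "is_quad ?E1" "is_quad ?E2" "is_quad ?E3" "is_quad F"
    using T E1 E2 E3 F quadrangulation_is_quad by blast+
  \<comment> \<open>The six edges not containing \<open>v\<close>, which noncollinearity keeps away
    from \<open>v\<close>. In a disc missing \<open>K\<close> only the spokes to \<open>a\<close>,
    \<open>b\<close>, \<open>c\<close> remain.\<close>
  define K where "K = closed_segment a p \<union> closed_segment p b \<union> closed_segment b q \<union>
    closed_segment q c \<union> closed_segment c r \<union> closed_segment r a"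
  have "closed K" unfolding K_def by (intro closed_Un closed_segment)
  moreover have "v \<notin> K"
  proof -
    have "v \<notin> closed_segment x y \<union> closed_segment y z" if q: "quad_conds v x y z" for x y z
    proof -
      have "collinear {v, x, y}" if "v \<in> closed_segment x y" for x y
        by (rule collinear_subset[OF collinear_closed_segment[of x y]]) (simp add: that)
      then show ?thesis using q by (auto simp: quad_conds_def insert_commute)
    qed
    then show ?thesis using q(1-3)[THEN is_quad_conds] unfolding K_def by blast
  qed
  ultimately obtain e where e: "e > 0" "ball v e \<inter> K = {}"
    by (metis Compl_iff disjoint_eq_subset_Compl open_Compl open_contains_ball)
  define W where "W = qregion ?E1 \<union> qregion ?E2 \<union> qregion ?E3"
  have "closed W" using q by (auto simp: W_def qregion_closure)
  define B where "B = ball v e - {v}"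
  have "connected B" unfolding B_def by (rule connected_punctured_ball) auto
  have edge: "x \<in> interior W"
    if "x \<in> closed_segment v y" "x \<in> B" "{v, y} \<in> D1" "{v, y} \<in> D2" "D1 \<noteq> D2" "y \<in> K"
      "D1 \<in> {?E1, ?E2, ?E3}" "D2 \<in> {?E1, ?E2, ?E3}" for x y D1 D2
  proof -
    have "D1 \<in> T" "D2 \<in> T" using that E1 E2 E3 by auto
    moreover have "x \<noteq> y" "x \<noteq> v" using that e by (auto simp: B_def)
    ultimately have "x \<in> interior (qregion D1 \<union> qregion D2)"
      using that quad_int_disjoint[OF T] quadrangulation_is_quad[OF T]
      by (intro common_edge_interior) (auto simp: open_segment_def)
    moreover have "qregion D1 \<union> qregion D2 \<subseteq> W" using that by (auto simp: W_def)
    ultimately show ?thesis using interior_mono by blast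
  qed
  have "W \<inter> B \<subseteq> interior W"
  proof
    fix x assume x: "x \<in> W \<inter> B"
    have "quad_int D \<subseteq> interior W" if "D \<in> {?E1, ?E2, ?E3}" for D
      using that q by (intro interior_maximal) (auto simp: W_def qregion_eq open_quad_int)
    moreover have "x \<in> quad_int ?E1 \<union> quad_int ?E2 \<union> quad_int ?E3
        \<union> quad_bd ?E1 \<union> quad_bd ?E2 \<union> quad_bd ?E3"
      using x q by (auto simp: W_def qregion_eq)
    moreover have "x \<in> K \<union> closed_segment v a \<union> closed_segment v b \<union> closed_segment v c"
      if "x \<in> quad_bd ?E1 \<union> quad_bd ?E2 \<union> quad_bd ?E3"
      using that by (auto simp: quad_bd_cyc K_def closed_segment_commute)
    moreover have "x \<notin> K" using x e by (auto simp: B_def)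
    moreover have "a \<in> K" "b \<in> K" "c \<in> K" by (auto simp: K_def)
    moreover have "{v, a} \<in> ?E1" "{v, a} \<in> ?E3" "{v, b} \<in> ?E1" "{v, b} \<in> ?E2" "{v, c} \<in> ?E2" "{v, c} \<in> ?E3"
      by (auto simp: cyc_def)
    ultimately show "x \<in> interior W"
      using edge[of x a ?E1 ?E3] edge[of x b ?E1 ?E2] edge[of x c ?E2 ?E3] x ne by blast
  qed
  moreover have "B \<inter> W \<noteq> {}"
  proof -
    have "v \<noteq> a" using q(1)[THEN is_quad_conds] by (auto simp: quad_conds_def)
    then have "v \<in> ball v e \<inter> closure (open_segment v a)" using e(1) by simp
    then have "ball v e \<inter> closure (open_segment v a) \<noteq> {}" by blast
    then have "ball v e \<inter> open_segment v a \<noteq> {}" unfolding open_Int_closure_eq_empty[OF open_ball] .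
    then obtain x where "x \<in> ball v e" "x \<in> open_segment v a" by blast
    then have "x \<in> B" "x \<in> closed_segment v a" by (auto simp: B_def open_segment_def)
    then show ?thesis using q(1) by (auto simp: W_def qregion_eq quad_bd_cyc)
  qed
  ultimately have "B \<subseteq> W"
    using connectedD[OF \<open>connected B\<close> open_interior[of W] open_Compl[OF \<open>closed W\<close>]] interior_subset[of W]
    by blast
  then have "ball v e \<subseteq> W"
    using qregion_eq[OF q(1)] qverts_subset_quad_bd[of ?E1] by (auto simp: B_def W_def qverts_def)
  \<comment> \<open>Interior points of \<open>F\<close> accumulate at \<open>v\<close> and so fall
    into the disc filled by the three quadrilaterals, contradicting disjoint interiors.\<close>
  have "v \<in> closure (quad_int F)"
    using F qverts_subset_quad_bd qregion_eq[OF q(4)] qregion_closure[OF q(4)] by blast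
  then have "ball v e \<inter> quad_int F \<noteq> {}"
    using e(1) by (metis centre_in_ball open_Int_closure_eq_empty open_ball Int_iff empty_iff)
  then obtain x where x: "x \<in> quad_int F" "x \<in> W" using \<open>ball v e \<subseteq> W\<close> by blast
  then obtain D where D: "D \<in> {?E1, ?E2, ?E3}" "x \<in> closure (quad_int D)"
    using q by (auto simp: W_def qregion_closure)
  then have "quad_int F \<inter> quad_int D \<noteq> {}"
    using x open_quad_int[OF q(4)] open_Int_closure_eq_empty by blast
  moreover have "D \<in> T" "D \<noteq> F" using D nF E1 E2 E3 by auto
  ultimately show False using quad_int_disjoint[OF T] F(1) by blast
qed

section \<open>Local topology of the realization\<close>

definition cube_faces :: "(bool \<Rightarrow> bool \<Rightarrow> bool \<Rightarrow> 'a) \<Rightarrow> bool \<Rightarrow> 'a set set set" where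
  "cube_faces g b = {face_x g b, face_y g b, face_z g b}"

definition cube_inj :: "(bool \<Rightarrow> bool \<Rightarrow> bool \<Rightarrow> 'a) \<Rightarrow> bool" where
  "cube_inj g \<longleftrightarrow> (\<forall>a b c a' b' c'. g a b c = g a' b' c' \<longleftrightarrow> a = a' \<and> b = b' \<and> c = c')"

text \<open>Invariance of domain: \<open>f\<close> after the homeomorphism maps an open part of the
  ball injectively into space, so its image is open; but it lies in a closed half-space and touches
  the bounding plane at \<open>f p\<close>.\<close>

lemma no_halfspace_chart:
  fixes X W :: "('a :: topological_space) set" and f :: "'a \<Rightarrow> real ^ 3" and c :: "real ^ 3"
  assumes U: "openin (top_of_set X) U" and hom: "U homeomorphic ball c r"
    and W: "open W" and p: "p \<in> U" "p \<in> W"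
    and f: "continuous_on UNIV f" and inj: "inj_on f (X \<inter> W)"
    and ge: "\<And>u. u \<in> X \<inter> W \<Longrightarrow> f u $ 1 \<ge> 0" and fp: "f p $ 1 = 0"
  shows False
proof -
  obtain h k where hk: "homeomorphism (ball c r) U h k"
    using hom homeomorphic_sym homeomorphic_def by metis
  have UX: "U \<subseteq> X" using U openin_subset by fastforce
  define V where "V = ball c r \<inter> h -` W"
  have ch: "continuous_on (ball c r) h" and hU: "h ` ball c r = U"
    and kh: "\<And>y. y \<in> ball c r \<Longrightarrow> k (h y) = y" and hk': "\<And>u. u \<in> U \<Longrightarrow> h (k u) = u"
    and kU: "k ` U = ball c r"
    using hk by (auto simp: homeomorphism_def)
  have "open V" unfolding V_def using continuous_open_preimage[OF ch open_ball W] .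
  have hV: "h y \<in> X \<inter> W" if "y \<in> V" for y using that hU UX by (auto simp: V_def)
  have "continuous_on V (f \<circ> h)"
    using ch f by (intro continuous_on_compose) (auto intro: continuous_on_subset simp: V_def)
  moreover have "inj_on (f \<circ> h) V"
  proof (rule comp_inj_on)
    show "inj_on h V" by (rule inj_on_inverseI[of _ k]) (simp add: kh V_def)
    show "inj_on f (h ` V)" using inj by (rule inj_on_subset) (use hV in blast)
  qed
  ultimately have op: "open ((f \<circ> h) ` V)" using \<open>open V\<close> by (intro invariance_of_domain)
  have "k p \<in> V" using p kU hk' by (auto simp: V_def)
  then have "f p \<in> (f \<circ> h) ` V" using hk'[OF p(1)] by (metis comp_apply imageI)
  then obtain e where e: "e > 0" "ball (f p) e \<subseteq> (f \<circ> h) ` V" using op open_contains_ball by blast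
  have "f p - (e / 2) *\<^sub>R axis 1 1 \<in> ball (f p) e" using e(1) by (simp add: dist_norm norm_axis_1)
  with e(2) have "f p - (e / 2) *\<^sub>R axis 1 1 \<in> (f \<circ> h) ` V" by (rule subsetD)
  then obtain y where "f p - (e / 2) *\<^sub>R axis 1 1 = f (h y)" "y \<in> V" by (auto elim: imageE)
  then have "0 \<le> (f p - (e / 2) *\<^sub>R axis 1 1) $ 1" using ge hV by metis
  then show False using fp e(1) by (simp add: axis_def)
qed

lemma compact_imp_closed_fun:
  fixes K :: "('a \<Rightarrow> real) set"
  assumes "compact K"
  shows "closed K"
proof -
  have "Hausdorff_space (euclidean :: ('a \<Rightarrow> real) topology)"
    by (metis Hausdorff_space_euclidean Hausdorff_space_product_topology euclidean_product_topology)
  then show ?thesis using compactin_imp_closedin[of euclidean K] assms by auto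
qed

lemma sum_bool3: "(\<Sum>p\<in>(UNIV :: (bool \<times> bool \<times> bool) set). case p of (i, j, k) \<Rightarrow> F i j k) =
    F False False False + F False False True + F False True False + F False True True +
    F True False False + F True False True + F True True False + (F True True True :: real)"
proof -
  have "(\<Sum>i\<in>UNIV. \<Sum>j\<in>UNIV. \<Sum>k\<in>UNIV. F i j k) =
      (\<Sum>p\<in>(UNIV :: (bool \<times> bool \<times> bool) set). case p of (i, j, k) \<Rightarrow> F i j k)"
    by (simp only: sum.cartesian_product UNIV_Times_UNIV)
  then show ?thesis by (simp add: UNIV_bool)
qed

lemma cubept_eq:
  fixes u :: 'a
  shows "cubept g x y z u =
    of_bool (u = g False False False) * ((1 - x) * (1 - y) * (1 - z)) +
    of_bool (u = g False False True) * ((1 - x) * (1 - y) * z) +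
    of_bool (u = g False True False) * ((1 - x) * y * (1 - z)) +
    of_bool (u = g False True True) * ((1 - x) * y * z) +
    of_bool (u = g True False False) * (x * (1 - y) * (1 - z)) +
    of_bool (u = g True False True) * (x * (1 - y) * z) +
    of_bool (u = g True True False) * (x * y * (1 - z)) +
    of_bool (u = g True True True) * (x * y * z)"
proof -
  have *: "(if p = u then e else 0) = of_bool (u = p) * e" for p :: 'a and e :: real
    by (cases "p = u") simp_all
  show ?thesis unfolding cubept_def sum_bool3 * by (simp add: wt_def)
qed

lemma sqpt_eq: "sqpt a b c d s t u =
    of_bool (u = a) * ((1 - s) * (1 - t)) + of_bool (u = b) * (s * (1 - t)) +
    of_bool (u = c) * (s * t) + of_bool (u = d) * ((1 - s) * t)"
proof -
  have *: "(if p then e else 0) = of_bool p * e" for p and e :: real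
    by (cases p) simp_all
  show ?thesis unfolding sqpt_def * by simp
qed

section \<open>Cells of the realization and their parametrizations\<close>

definition cube_cell :: "(bool \<Rightarrow> bool \<Rightarrow> bool \<Rightarrow> 'a) \<Rightarrow> ('a \<Rightarrow> real) set" where
  "cube_cell g = {cubept g x y z | x y z. x \<in> {0..1} \<and> y \<in> {0..1} \<and> z \<in> {0..1}}"

definition square_cell :: "'a set set \<Rightarrow> ('a \<Rightarrow> real) set" where
  "square_cell F = {sqpt a b c d s t | a b c d s t. F = cyc a b c d \<and> s \<in> {0..1} \<and> t \<in> {0..1}}"

lemma compact_cube_cell: "compact (cube_cell g)"
proof -
  have "cube_cell g = (\<lambda>(x, y, z). cubept g x y z) ` ({0..1} \<times> {0..1} \<times> {0..1})"
    unfolding cube_cell_def set_eq_iff image_iff by (simp del: atLeastAtMost_iff) blast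
  moreover have "continuous_on ({0..1} \<times> {0..1} \<times> {0..1}) (\<lambda>(x, y, z). cubept g x y z)"
    unfolding split_def
    by (intro continuous_on_coordinatewise_then_product, unfold cubept_eq, intro continuous_intros)
  ultimately show ?thesis by (simp add: compact_continuous_image compact_Times)
qed

lemma sqpt_rotate: "sqpt a b c d s t = sqpt b c d a t (1 - s)"
  by (rule ext) (simp add: sqpt_eq algebra_simps)

lemma sqpt_reverse: "sqpt a b c d s t = sqpt a d c b t s"
  by (rule ext) (simp add: sqpt_eq algebra_simps)

text \<open>Another reading of the edge set changes the bilinear parametrization by a symmetry of
  the unit square, so a single reading covers the union over all readings.\<close>

lemma square_cell_eq:
  assumes "distinct [a, b, c, d]"
  shows "square_cell (cyc a b c d) = {sqpt a b c d s t | s t. s \<in> {0..1} \<and> t \<in> {0..1}}"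
proof -
  define Q where "Q a b c d = {sqpt a b c d s t | s t. s \<in> {0..1} \<and> t \<in> {0..1}}" for a b c d :: 'a
  have rot: "Q a b c d = Q b c d a" for a b c d
  proof -
    have *: "Q a b c d \<subseteq> Q b c d a" for a b c d
      using sqpt_rotate[of a b c d] by (fastforce simp: Q_def)
    show ?thesis using *[of a b c d] *[of b c d a] *[of c d a b] *[of d a b c] by blast
  qed
  have rev: "Q a b c d = Q a d c b" for a b c d
    using sqpt_reverse[of a b c d] sqpt_reverse[of a d c b] by (fastforce simp: Q_def)
  have "Q p q r s = Q a b c d" if "cyc a b c d = cyc p q r s" for p q r s
  proof -
    have 1: "Q b c d a = Q a b c d" "Q c d a b = Q a b c d" "Q d a b c = Q a b c d" "Q a d c b = Q a b c d"
      using rot[of a b c d] rot[of b c d a] rot[of c d a b] rev[of a b c d] by simp_all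
    have 2: "Q d c b a = Q a b c d" "Q c b a d = Q a b c d" "Q b a d c = Q a b c d"
      using rot[of a d c b] rot[of d c b a] rot[of c b a d] 1(4) by simp_all
    show ?thesis using cyc_eqD[OF assms that] by (elim insertE) (simp_all add: 1 2)
  qed
  then have "square_cell (cyc a b c d) \<subseteq> Q a b c d"
    unfolding square_cell_def Q_def by blast
  moreover have "Q a b c d \<subseteq> square_cell (cyc a b c d)"
    unfolding square_cell_def Q_def by blast
  ultimately show ?thesis unfolding Q_def by blast
qed

lemma cubept_face:
  "cubept g 0 y z = sqpt (g False False False) (g False True False) (g False True True) (g False False True) y z"
  "cubept g 1 y z = sqpt (g True False False) (g True True False) (g True True True) (g True False True) y z"
  "cubept g x 0 z = sqpt (g False False False) (g True False False) (g True False True) (g False False True) x z"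
  "cubept g x 1 z = sqpt (g False True False) (g True True False) (g True True True) (g False True True) x z"
  "cubept g x y 0 = sqpt (g False False False) (g True False False) (g True True False) (g False True False) x y"
  "cubept g x y 1 = sqpt (g False False True) (g True False True) (g True True True) (g False True True) x y"
  by (rule ext; simp add: cubept_eq sqpt_eq)+

lemma cube_cell_permute:
  "cube_cell (\<lambda>i j k. g j i k) = cube_cell g"
  "cube_cell (\<lambda>i j k. g j k i) = cube_cell g"
proof -
  have "cubept (\<lambda>i j k. g j i k) x y z = cubept g y x z" "cubept (\<lambda>i j k. g j k i) x y z = cubept g y z x" for x y z
    by (rule ext; simp add: cubept_eq)+
  then show "cube_cell (\<lambda>i j k. g j i k) = cube_cell g" "cube_cell (\<lambda>i j k. g j k i) = cube_cell g"
    unfolding cube_cell_def by auto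
qed

lemma cube_cell_flip: "cube_cell (\<lambda>i. g (\<not> i)) = cube_cell g"
proof -
  have *: "cubept (\<lambda>i. g (\<not> i)) x y z = cubept g (1 - x) y z" for x y z and g :: "bool \<Rightarrow> bool \<Rightarrow> bool \<Rightarrow> 'a"
    by (rule ext; simp add: cubept_eq)
  then have **: "cube_cell (\<lambda>i. g (\<not> i)) \<subseteq> cube_cell g" for g :: "bool \<Rightarrow> bool \<Rightarrow> bool \<Rightarrow> 'a"
    unfolding cube_cell_def by fastforce
  show ?thesis using **[of g] **[of "\<lambda>i. g (\<not> i)"] by simp
qed

text \<open>Permuting the axes and reversing the first one leave the cell unchanged, so it suffices
  to treat the face on which the first coordinate vanishes.\<close>

lemma cube_face_normal_form:
  assumes g: "cube_inj g" and S: "S \<in> cube_faces g b"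
  obtains g' where "cube_inj g'" "S = face_x g' False" "cube_cell g' = cube_cell g"
proof -
  have "\<exists>g1. cube_inj g1 \<and> S = face_x g1 b \<and> cube_cell g1 = cube_cell g"
  proof -
    consider "S = face_x g b" | "S = face_y g b" | "S = face_z g b"
      using S by (auto simp: cube_faces_def)
    then show ?thesis
    proof cases
      case 1
      then show ?thesis using g by blast
    next
      case 2
      then have "S = face_x (\<lambda>i j k. g j i k) b" by (simp add: face_x_def face_y_def)
      moreover have "cube_inj (\<lambda>i j k. g j i k)" using g unfolding cube_inj_def by auto
      ultimately show ?thesis by (intro exI[of _ "\<lambda>i j k. g j i k"] conjI cube_cell_permute(1))
    next
      case 3
      then have "S = face_x (\<lambda>i j k. g j k i) b" by (simp add: face_x_def face_z_def)
      moreover have "cube_inj (\<lambda>i j k. g j k i)" using g unfolding cube_inj_def by auto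
      ultimately show ?thesis by (intro exI[of _ "\<lambda>i j k. g j k i"] conjI cube_cell_permute(2))
    qed
  qed
  then obtain g1 where g1: "cube_inj g1" "S = face_x g1 b" "cube_cell g1 = cube_cell g" by blast
  show thesis
  proof (cases b)
    case False
    then show ?thesis using g1 by (intro that[of g1]) simp_all
  next
    case True
    have "cube_inj (\<lambda>i. g1 (\<not> i))" using g1(1) unfolding cube_inj_def by auto
    moreover have "S = face_x (\<lambda>i. g1 (\<not> i)) False" using g1(2) True by (simp add: face_x_def)
    moreover have "cube_cell (\<lambda>i. g1 (\<not> i)) = cube_cell g" using cube_cell_flip[of g1] g1(3) by simp
    ultimately show ?thesis by (rule that)
  qed
qed

lemma arg_cong3: "a = a' \<Longrightarrow> b = b' \<Longrightarrow> c = c' \<Longrightarrow> f a b c = f a' b' c'"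
  by simp

text \<open>The coordinates of a point of the cube are sums of its weights over three faces.\<close>
lemma cube_face_chart:
  assumes g: "cube_inj g" and S: "S \<in> cube_faces g b"
  obtains f :: "('a \<Rightarrow> real) \<Rightarrow> real ^ 3" where "continuous_on UNIV f" "inj_on f (cube_cell g)"
    "\<forall>u\<in>cube_cell g. f u $ 1 \<ge> 0" "\<forall>u\<in>square_cell S. f u $ 1 = 0"
    "square_cell S \<subseteq> cube_cell g"
proof -
  obtain g' where g': "cube_inj g'" "S = face_x g' False" "cube_cell g' = cube_cell g"
    using cube_face_normal_form[OF g S] .
  define V :: "real \<Rightarrow> real \<Rightarrow> real \<Rightarrow> real ^ 3" where
    "V x y z = x *\<^sub>R axis 1 1 + y *\<^sub>R axis 2 1 + z *\<^sub>R axis 3 1" for x y z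
  have V: "V x y z $ 1 = x" "V x y z $ 2 = y" "V x y z $ 3 = z" for x y z
    by (simp_all add: V_def axis_def)
  define f where
    "f u = V (u (g' True False False) + u (g' True False True) + u (g' True True False) + u (g' True True True))
       (u (g' False True False) + u (g' False True True) + u (g' True True False) + u (g' True True True))
       (u (g' False False True) + u (g' False True True) + u (g' True False True) + u (g' True True True))" for u
  have inj: "g' a b c = g' a' b' c' \<longleftrightarrow> a = a' \<and> b = b' \<and> c = c'" for a b c a' b' c'
    using g'(1) by (simp add: cube_inj_def)
  have f: "f (cubept g' x y z) = V x y z" for x y z
    unfolding f_def cubept_eq inj by (rule arg_cong3[where f = V]) (simp_all add: algebra_simps)
  have sq: "square_cell S = {cubept g' 0 y z | y z. y \<in> {0..1} \<and> z \<in> {0..1}}"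
    unfolding g'(2) face_x_def cubept_face by (rule square_cell_eq) (simp add: inj)
  show thesis
  proof (rule that)
    show "continuous_on UNIV f"
      unfolding f_def V_def by (intro continuous_intros continuous_on_product_coordinates)
    show "inj_on f (cube_cell g)"
      unfolding g'(3)[symmetric]
      by (rule inj_on_inverseI[where g = "\<lambda>w. cubept g' (w $ 1) (w $ 2) (w $ 3)"]) (auto simp: cube_cell_def f V)
    show "\<forall>u\<in>cube_cell g. f u $ 1 \<ge> 0"
      unfolding g'(3)[symmetric] by (auto simp: cube_cell_def f V)
    show "\<forall>u\<in>square_cell S. f u $ 1 = 0"
      unfolding sq by (auto simp: f V)
    show "square_cell S \<subseteq> cube_cell g"
      unfolding sq g'(3)[symmetric] unfolding cube_cell_def
    proof clarify
      fix y z :: real assume "y \<in> {0..1}" "z \<in> {0..1}"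
      then show "\<exists>x' y' z'. cubept g' 0 y z = cubept g' x' y' z' \<and> x' \<in> {0..1} \<and> y' \<in> {0..1} \<and> z' \<in> {0..1}"
        by (intro exI[of _ 0] exI[of _ y] exI[of _ z]) auto
    qed
  qed
qed

text \<open>The inequalities single out one of the three cyclic orders on the support of a point of a square,
  whose weights satisfy the equation below for the correct order.\<close>
lemma cyc_eq_of_weights:
  fixes u :: "'a \<Rightarrow> real"
  assumes d: "distinct [v, a, b, c]" and pos: "u v > 0" "u a > 0" "u b > 0" "u c > 0"
    and gt: "u v * u a > u b * u c" "u v * u c > u a * u b"
    and zero: "\<And>q. q \<notin> {a', b', c', d'} \<Longrightarrow> u q = 0" and eq: "u a' * u c' = u b' * u d'"
  shows "cyc a' b' c' d' = cyc v a b c"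
proof -
  have main: "cyc v b' c' d' = cyc v a b c"
    if zero: "\<And>q. q \<notin> {v, b', c', d'} \<Longrightarrow> u q = 0" and eq: "u v * u c' = u b' * u d'" for b' c' d'
  proof -
    have "a \<in> {v, b', c', d'}" "b \<in> {v, b', c', d'}" "c \<in> {v, b', c', d'}"
      using zero pos by fastforce+
    then have "a \<in> {b', c', d'}" "b \<in> {b', c', d'}" "c \<in> {b', c', d'}" using d by auto
    then consider "b' = a" "c' = b" "d' = c" | "b' = c" "c' = b" "d' = a" | "b' = b" "c' = a" "d' = c"
      | "b' = c" "c' = a" "d' = b" | "b' = a" "c' = c" "d' = b" | "b' = b" "c' = c" "d' = a"
      using d by auto
    then show ?thesis
      \<comment> \<open>The equation puts \<open>c'\<close> opposite to \<open>v\<close>. The two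
        inequalities exclude \<open>c' = a\<close> and \<open>c' = c\<close>, which leaves
        \<open>b\<close> as the opposite vertex.\<close>
      by cases (use gt eq in \<open>simp_all add: mult.commute cyc_reverse[of v c b a]\<close>)
  qed
  have "v \<in> {a', b', c', d'}" using zero pos by fastforce
  then consider "v = a'" | "v = b'" | "v = c'" | "v = d'" by blast
  then show ?thesis
  proof cases
    case 1
    then show ?thesis using main[of b' c' d'] zero eq by blast
  next
    case 2
    have "cyc v c' d' a' = cyc v a b c"
      by (rule main) (use zero eq 2 in \<open>auto simp: mult.commute\<close>)
    then show ?thesis using 2 cyc_rotate by metis
  next
    case 3
    have "cyc v d' a' b' = cyc v a b c"
      by (rule main) (use zero eq 3 in \<open>auto simp: mult.commute\<close>)
    then show ?thesis using 3 cyc_rotate by metis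
  next
    case 4
    have "cyc v a' b' c' = cyc v a b c"
      by (rule main) (use zero eq 4 in \<open>auto simp: mult.commute\<close>)
    then show ?thesis using 4 cyc_rotate by metis
  qed
qed

text \<open>Four positive weights force the corners to be distinct; then both products of opposite
  weights equal \<open>s * (1 - s) * t * (1 - t)\<close>.\<close>

lemma generic_point_of_square:
  fixes u :: "'a \<Rightarrow> real"
  assumes d: "distinct [v, a, b, c]" and pos: "u v > 0" "u a > 0" "u b > 0" "u c > 0"
    and gt: "u v * u a > u b * u c" "u v * u c > u a * u b"
    and u: "u = sqpt a' b' c' d' s t"
  shows "cyc a' b' c' d' = cyc v a b c"
proof -
  have zero: "u q = 0" if "q \<notin> {a', b', c', d'}" for q
    using that by (simp add: u sqpt_eq)
  then have "{v, a, b, c} \<subseteq> {a', b', c', d'}" using pos by fastforce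
  then have "card {v, a, b, c} \<le> card {a', b', c', d'}" by (intro card_mono) simp_all
  then have "card {a', b', c', d'} \<ge> 4" using d by simp
  then have "card (set [a', b', c', d']) = length [a', b', c', d']"
    using card_length[of "[a', b', c', d']"] by simp
  then have "distinct [a', b', c', d']" by (rule card_distinct)
  then have "u a' * u c' = u b' * u d'" by (auto simp: u sqpt_eq)
  then show ?thesis using cyc_eq_of_weights[OF d pos gt zero] by simp
qed

text \<open>An interior point of a cube has positive weight on all eight corners, but
  \<open>u\<close> is supported on four vertices; so it lies on a face, and that face is identified
  as a square. Five corners are enough for the count.\<close>

lemma generic_point_of_cube:
  fixes u :: "'a \<Rightarrow> real"
  assumes d: "distinct [v, a, b, c]" and pos: "u v > 0" "u a > 0" "u b > 0" "u c > 0"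
    and gt: "u v * u a > u b * u c" "u v * u c > u a * u b"
    and zero: "\<And>q. q \<notin> {v, a, b, c} \<Longrightarrow> u q = 0"
    and g: "cube_inj g" and u: "u \<in> cube_cell g"
  shows "cyc v a b c \<in> cube_faces g False \<union> cube_faces g True"
proof -
  obtain x y z where u: "u = cubept g x y z" and r: "x \<in> {0..1}" "y \<in> {0..1}" "z \<in> {0..1}"
    using u by (auto simp: cube_cell_def)
  have inj: "g i j k = g i' j' k' \<longleftrightarrow> i = i' \<and> j = j' \<and> k = k'" for i j k i' j' k'
    using g by (simp add: cube_inj_def)
  have "x \<in> {0, 1} \<or> y \<in> {0, 1} \<or> z \<in> {0, 1}"
  proof (rule ccontr)
    assume "\<not> ?thesis"
    then have s: "0 < x" "0 < y" "0 < z" "0 < 1 - x" "0 < 1 - y" "0 < 1 - z" using r by auto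
    have p: "u (g False False False) > 0" "u (g False False True) > 0" "u (g False True False) > 0"
      "u (g False True True) > 0" "u (g True False False) > 0"
      using s by (simp_all only: u cubept_eq inj) simp_all
    have mem: "q \<in> {v, a, b, c}" if "u q > 0" for q using zero[of q] that by (cases "q \<in> {v, a, b, c}") auto
    have "{g False False False, g False False True, g False True False, g False True True, g True False False}
        \<subseteq> {v, a, b, c}"
      using p[THEN mem] by simp
    then have "card {g False False False, g False False True, g False True False, g False True True, g True False False}
        \<le> card {v, a, b, c}"
      by (intro card_mono) simp_all
    then show False using d by (simp add: inj)
  qed
  then consider "x = 0" | "x = 1" | "y = 0" | "y = 1" | "z = 0" | "z = 1" by blast
  then show ?thesis
  proof cases
    case 1
    then show ?thesis
      using generic_point_of_square[OF d pos gt, OF u[unfolded 1 cubept_face]] by (simp add: cube_faces_def face_x_def)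
  next
    case 2
    then show ?thesis
      using generic_point_of_square[OF d pos gt, OF u[unfolded 2 cubept_face]] by (simp add: cube_faces_def face_x_def)
  next
    case 3
    then show ?thesis
      using generic_point_of_square[OF d pos gt, OF u[unfolded 3 cubept_face]] by (simp add: cube_faces_def face_y_def)
  next
    case 4
    then show ?thesis
      using generic_point_of_square[OF d pos gt, OF u[unfolded 4 cubept_face]] by (simp add: cube_faces_def face_y_def)
  next
    case 5
    then show ?thesis
      using generic_point_of_square[OF d pos gt, OF u[unfolded 5 cubept_face]] by (simp add: cube_faces_def face_z_def)
  next
    case 6
    then show ?thesis
      using generic_point_of_square[OF d pos gt, OF u[unfolded 6 cubept_face]] by (simp add: cube_faces_def face_z_def)
  qed
qed

text \<open>Otherwise the complex has a boundary point in the interior of the face S, arbitrarily close to v.\<close>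
lemma interior_face_two_cubes:
  fixes X :: "('a \<Rightarrow> real) set" and c0 :: "real ^ 3"
  assumes I: "finite I" "\<And>i. i \<in> I \<Longrightarrow> cube_inj (G i)"
    and X: "X = (\<Union>F\<in>K. square_cell F) \<union> (\<Union>i\<in>I. cube_cell (G i))"
    and S: "cyc v a b c \<in> K" "distinct [v, a, b, c]"
    and U: "openin (top_of_set X) U" "(\<lambda>u. if u = v then 1 else 0) \<in> U" "U homeomorphic ball c0 r"
  shows "\<exists>i\<in>I. \<exists>j\<in>I. i \<noteq> j \<and> cyc v a b c \<in> cube_faces (G i) False \<union> cube_faces (G i) True
    \<and> cyc v a b c \<in> cube_faces (G j) False \<union> cube_faces (G j) True"
proof (rule ccontr)
  assume no: "\<not> ?thesis"
  let ?S = "cyc v a b c"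
  define J where "J = {i \<in> I. ?S \<in> cube_faces (G i) False \<union> cube_faces (G i) True}"
  obtain W2 where W2: "open W2" "U = X \<inter> W2" using U(1) by (auto simp: openin_open)
  \<comment> \<open>The diagonal of the square, leaving \<open>v\<close> at parameter 0.\<close>
  define q where "q e = sqpt v a b c e e" for e
  have "continuous_on UNIV q"
    by (rule continuous_on_coordinatewise_then_product) (unfold q_def sqpt_eq, intro continuous_intros)
  then have "open (q -` W2)" using W2(1) by (simp add: open_vimage)
  moreover have "q 0 = (\<lambda>u. if u = v then 1 else 0)" by (rule ext) (simp add: q_def sqpt_eq)
  then have "0 \<in> q -` W2" using U(2) W2(2) by simp
  ultimately obtain dd where dd: "dd > 0" "ball 0 dd \<subseteq> q -` W2" using open_contains_ball by blast
  \<comment> \<open>The first bound keeps \<open>p\<close> in the chart. The second makes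
    \<open>e < 1 - e\<close>, so that the weight of \<open>v\<close> dominates and the inequalities
    of \<open>W1\<close> hold.\<close>
  define e where "e = min (dd / 2) (1 / 4)"
  have e: "0 < e" "e < 1 - e" "e \<in> ball 0 dd" using dd(1) by (auto simp: e_def)
  define p where "p = q e"
  have pW2: "p \<in> W2" using e(3) dd(2) by (auto simp: p_def)
  have "e \<in> {0..1}" using e by simp
  then have pS: "p \<in> square_cell ?S" unfolding square_cell_eq[OF S(2)] p_def q_def by blast
  then have pU: "p \<in> U" using pW2 W2(2) X S(1) by auto
  define W1 where "W1 = {u :: 'a \<Rightarrow> real. u v > 0 \<and> u a > 0 \<and> u b > 0 \<and> u c > 0 \<and>
    u v * u a > u b * u c \<and> u v * u c > u a * u b}"
  have "open W1"
    unfolding W1_def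
    by (intro open_Collect_conj open_Collect_less continuous_intros continuous_on_product_coordinates)
  have pv: "p v = (1 - e) * (1 - e)" "p a = e * (1 - e)" "p b = e * e" "p c = (1 - e) * e"
    using S(2) by (auto simp: p_def q_def sqpt_eq)
  have "e * e < (1 - e) * (1 - e)" using e by (intro mult_strict_mono) auto
  then have "(e * (1 - e)) * (e * e) < (e * (1 - e)) * ((1 - e) * (1 - e))"
    using e by (intro mult_strict_left_mono) auto
  then have "p v * p a > p b * p c" "p v * p c > p a * p b" unfolding pv by (simp_all add: algebra_simps)
  moreover have "p v > 0" "p a > 0" "p b > 0" "p c > 0" unfolding pv using e by simp_all
  ultimately have pW1: "p \<in> W1" unfolding W1_def by blast
  \<comment> \<open>The cubes not bounded by the face: finitely many compact cells, none of which
    contains the generic point \<open>p\<close>, so a neighbourhood avoids them.\<close>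
  define C where "C = (\<Union>i\<in>I - J. cube_cell (G i))"
  have "closed C"
    unfolding C_def using I(1) by (intro closed_UN) (auto intro: compact_imp_closed_fun compact_cube_cell)
  have "p \<notin> C"
  proof
    assume "p \<in> C"
    then obtain i where i: "i \<in> I" "i \<notin> J" "p \<in> cube_cell (G i)" by (auto simp: C_def)
    have "?S \<in> cube_faces (G i) False \<union> cube_faces (G i) True"
      by (rule generic_point_of_cube[of v a b c p])
         (use S(2) pW1 i I(2) in \<open>auto simp: W1_def p_def q_def sqpt_eq\<close>)
    then show False using i by (simp add: J_def)
  qed
  define W where "W = W1 \<inter> - C"
  have W: "open W" "p \<in> W"
    using \<open>open W1\<close> \<open>closed C\<close> pW1 \<open>p \<notin> C\<close> by (auto simp: W_def)
  have XW: "X \<inter> W \<subseteq> square_cell ?S \<union> (\<Union>i\<in>J. cube_cell (G i))"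
  proof
    fix u assume u: "u \<in> X \<inter> W"
    then consider F where "F \<in> K" "u \<in> square_cell F" | i where "i \<in> I" "u \<in> cube_cell (G i)"
      unfolding X by blast
    then show "u \<in> square_cell ?S \<union> (\<Union>i\<in>J. cube_cell (G i))"
    proof cases
      case 1
      then obtain a' b' c' d' s t where F: "F = cyc a' b' c' d'" "u = sqpt a' b' c' d' s t"
        by (auto simp: square_cell_def)
      have "F = ?S" unfolding F(1)
        by (rule generic_point_of_square[OF S(2) _ _ _ _ _ _ F(2)]) (use u in \<open>auto simp: W_def W1_def\<close>)
      then show ?thesis using 1 by simp
    next
      case 2
      then have "i \<in> J" using u by (auto simp: W_def C_def)
      then show ?thesis using 2 by blast
    qed
  qed
  obtain f :: "('a \<Rightarrow> real) \<Rightarrow> real ^ 3" and Y where f: "continuous_on UNIV f" "inj_on f Y"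
    "\<And>u. u \<in> Y \<Longrightarrow> f u $ 1 \<ge> 0" "\<And>u. u \<in> square_cell ?S \<Longrightarrow> f u $ 1 = 0" "X \<inter> W \<subseteq> Y"
  proof (cases "J = {}")
    case True
    \<comment> \<open>With no cube at the face, the complex is a bare square near \<open>p\<close>.
      The two sums recover its parameters, and mapping it into the plane of vanishing first
      coordinate is enough to contradict the chart.\<close>
    define f :: "('a \<Rightarrow> real) \<Rightarrow> real ^ 3" where
      "f u = (u a + u b) *\<^sub>R axis 2 1 + (u b + u c) *\<^sub>R axis 3 1" for u
    have f: "f u $ 1 = 0" "f u $ 2 = u a + u b" "f u $ 3 = u b + u c" for u
      by (simp_all add: f_def axis_def)
    have ff: "f (sqpt v a b c s t) $ 2 = s" "f (sqpt v a b c s t) $ 3 = t" for s t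
      unfolding f using S(2) by (auto simp: sqpt_eq algebra_simps)
    show ?thesis
    proof (rule that[of f "square_cell ?S"])
      show "continuous_on UNIV f"
        unfolding f_def by (intro continuous_intros continuous_on_product_coordinates)
      show "inj_on f (square_cell ?S)"
        unfolding square_cell_eq[OF S(2)]
        by (rule inj_on_inverseI[where g = "\<lambda>w. sqpt v a b c (w $ 2) (w $ 3)"]) (auto simp: ff)
      show "X \<inter> W \<subseteq> square_cell ?S" using XW True by simp
    qed (simp_all add: f)
  next
    case False
    then obtain i where i: "i \<in> I" "?S \<in> cube_faces (G i) False \<union> cube_faces (G i) True"
      by (auto simp: J_def)
    then obtain s where s: "?S \<in> cube_faces (G i) s" by blast
    have J: "J = {i}" using no i by (auto simp: J_def)
    obtain f :: "('a \<Rightarrow> real) \<Rightarrow> real ^ 3" where "continuous_on UNIV f" "inj_on f (cube_cell (G i))"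
      "\<forall>u\<in>cube_cell (G i). f u $ 1 \<ge> 0" "\<forall>u\<in>square_cell ?S. f u $ 1 = 0"
      "square_cell ?S \<subseteq> cube_cell (G i)"
      by (rule cube_face_chart[OF I(2)[OF i(1)] s])
    then show ?thesis using XW J by (intro that[of f "cube_cell (G i)"]) auto
  qed
  show False
  proof (rule no_halfspace_chart[OF U(1,3) W(1) pU W(2) f(1)])
    show "inj_on f (X \<inter> W)" using f(2,5) inj_on_subset by blast
    show "f u $ 1 \<ge> 0" if "u \<in> X \<inter> W" for u using f(3,5) that by blast
    show "f p $ 1 = 0" using f(4) pS .
  qed
qed

section \<open>The Kashaev equation on one cube\<close>

text \<open>\<open>?A\<close> is the square root relation on a new face; \<open>?B\<close>,
  \<open>?C\<close>, \<open>?D\<close> evaluate \<open>KC0\<close> at one vertex for each distance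
  1, 2, 3 from the bottom. The other vertices and faces follow by permuting the axes.\<close>

lemma cube_signed:
  fixes z000 :: complex
  assumes nz: "z000 \<noteq> 0"
    and X0: "X0\<^sup>2 = z000 * z011 + z010 * z001"
    and Y0: "Y0\<^sup>2 = z000 * z101 + z100 * z001"
    and Z0: "Z0\<^sup>2 = z000 * z110 + z100 * z010"
    and u: "u * u = 1"
    and K: "(z111 * z000\<^sup>2 - z000 * (z100 * z011 + z010 * z101 + z001 * z110)) / 2 - z100 * z010 * z001 = u * X0 * Y0 * Z0"
    and X1: "X1 = (u * Y0 * Z0 + X0 * z100) / z000"
    and Y1: "Y1 = (u * X0 * Z0 + Y0 * z010) / z000"
    and Z1: "Z1 = (u * X0 * Y0 + Z0 * z001) / z000"
  shows "X1\<^sup>2 = z100 * z111 + z110 * z101" (is ?A)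
    and "(z011 * z100\<^sup>2 - z100 * (z000 * z111 + z110 * z001 + z101 * z010)) / 2 - z000 * z110 * z101 = - (u * X1 * Y0 * Z0)" (is ?B)
    and "(z001 * z110\<^sup>2 - z110 * (z010 * z101 + z100 * z011 + z111 * z000)) / 2 - z010 * z100 * z111 = - (u * X1 * Y1 * Z0)" (is ?C)
    and "(z000 * z111\<^sup>2 - z111 * (z011 * z100 + z101 * z010 + z110 * z001)) / 2 - z011 * z101 * z110 = (u * X1 * Y1 * Z1)" (is ?D)
proof -
  have e: "z000 * X1 = u * Y0 * Z0 + X0 * z100" "z000 * Y1 = u * X0 * Z0 + Y0 * z010" "z000 * Z1 = u * X0 * Y0 + Z0 * z001"
    using nz X1 Y1 Z1 by (simp_all add: field_simps)
  have K': "z111 * z000\<^sup>2 = z000 * (z100 * z011 + z010 * z101 + z001 * z110) + 2 * z100 * z010 * z001 + 2 * u * X0 * Y0 * Z0"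
    using K by (simp add: field_simps)
  \<comment> \<open>In each of the four identities the power of \<open>z000\<close> equals the
    number of upper face values in it, so that substituting \<open>e\<close> clears all
    denominators.\<close>
  have "z000^2 * X1\<^sup>2 = z000^2 * (z100 * z111 + z110 * z101)"
    using e(1) K' X0 Y0 Z0 u by algebra
  then show ?A using nz by simp
  have "z000 * (z011 * z100\<^sup>2 - z100 * (z000 * z111 + z110 * z001 + z101 * z010) - 2 * z000 * z110 * z101) = z000 * (- 2* (u * X1 * Y0 * Z0))"
    using e(1) K' X0 Y0 Z0 u by algebra
  then have "(z011 * z100\<^sup>2 - z100 * (z000 * z111 + z110 * z001 + z101 * z010) - 2 * z000 * z110 * z101) =  (- 2* (u * X1 * Y0 * Z0))"
    using nz by (simp only: mult_cancel_left) auto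
  then show ?B by (simp add: field_simps)
  have "z000^2 * (z001 * z110\<^sup>2 - z110 * (z010 * z101 + z100 * z011 + z111 * z000) - 2 * z010 * z100 * z111) = z000^2 * (- 2* (u * X1 * Y1 * Z0))"
    using e K' X0 Y0 Z0 u by algebra
  then have "(z001 * z110\<^sup>2 - z110 * (z010 * z101 + z100 * z011 + z111 * z000) - 2 * z010 * z100 * z111) = (- 2* (u * X1 * Y1 * Z0))"
    using nz by (simp only: mult_cancel_left) auto
  then show ?C by (simp add: field_simps)
  have "z000^3 * (z000 * z111\<^sup>2 - z111 * (z011 * z100 + z101 * z010 + z110 * z001) - 2 * z011 * z101 * z110) = z000^3 * (2* (u * X1 * Y1 * Z1))"
    using e K' X0 Y0 Z0 u by algebra
  then have "(z000 * z111\<^sup>2 - z111 * (z011 * z100 + z101 * z010 + z110 * z001) - 2 * z011 * z101 * z110) =  (2* (u * X1 * Y1 * Z1))"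
    using nz by (simp only: mult_cancel_left) auto
  then show ?D by (simp add: field_simps)
qed

lemma cube_injD:
  assumes "cube_inj g"
  shows "g a b c = g a' b' c' \<longleftrightarrow> a = a' \<and> b = b' \<and> c = c'"
  using assms by (simp add: cube_inj_def)

lemma mem_cube_face:
  assumes "cube_inj g"
  shows "g i j k \<in> \<Union>(face_x g a) \<longleftrightarrow> i = a" "g i j k \<in> \<Union>(face_y g a) \<longleftrightarrow> j = a"
    "g i j k \<in> \<Union>(face_z g a) \<longleftrightarrow> k = a"
  unfolding face_x_def face_y_def face_z_def cyc_Union using cube_injD[OF assms] by auto

lemma cube_faces_distinct:
  assumes g: "cube_inj g"
  shows "face_x g a \<noteq> face_y g b" "face_y g b \<noteq> face_z g c" "face_x g a \<noteq> face_z g c"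
  using mem_cube_face[OF g, of a "\<not> b" c] mem_cube_face[OF g, of a b "\<not> c"] by metis+

lemma cube_faces_at:
  assumes g: "cube_inj g"
  shows "{S \<in> cube_faces g False \<union> cube_faces g True. g a b c \<in> \<Union>S} = {face_x g a, face_y g b, face_z g c}"
proof -
  have eq: "cube_faces g False \<union> cube_faces g True = range (face_x g) \<union> range (face_y g) \<union> range (face_z g)"
    by (auto simp: cube_faces_def UNIV_bool)
  define P where "P S \<longleftrightarrow> g a b c \<in> \<Union>S" for S
  have P: "P (face_x g i) \<longleftrightarrow> a = i" "P (face_y g i) \<longleftrightarrow> b = i" "P (face_z g i) \<longleftrightarrow> c = i" for i
    unfolding P_def by (rule mem_cube_face[OF g])+
  have "S \<in> range (face_x g) \<union> range (face_y g) \<union> range (face_z g) \<and> P S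
      \<longleftrightarrow> S = face_x g a \<or> S = face_y g b \<or> S = face_z g c" for S
  proof
    assume S: "S \<in> range (face_x g) \<union> range (face_y g) \<union> range (face_z g) \<and> P S"
    then consider i where "S = face_x g i" | i where "S = face_y g i" | i where "S = face_z g i" by blast
    then show "S = face_x g a \<or> S = face_y g b \<or> S = face_z g c"
      using S by cases (simp_all add: P)
  next
    assume "S = face_x g a \<or> S = face_y g b \<or> S = face_z g c"
    then show "S \<in> range (face_x g) \<union> range (face_y g) \<union> range (face_z g) \<and> P S"
      by (elim disjE) (simp_all add: P)
  qed
  then show ?thesis unfolding eq P_def by (rule_tac set_eqI) (simp only: mem_Collect_eq insert_iff empty_iff simp_thms)
qed

lemma prod_cube_faces_at:
  assumes g: "cube_inj g"
  shows "(\<Prod>S\<in>{S \<in> cube_faces g False \<union> cube_faces g True. g a b c \<in> \<Union>S}. f S)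
    = f (face_x g a) * f (face_y g b) * (f (face_z g c) :: 'b :: comm_monoid_mult)"
  unfolding cube_faces_at[OF g] using cube_faces_distinct[OF g] by (simp add: mult.assoc)

lemma face_in_corners:
  assumes "S \<in> cube_faces g b" "v \<in> \<Union>S"
  shows "v \<in> corners g"
proof -
  have c: "\<Union>(face_x g b) \<subseteq> corners g" "\<Union>(face_y g b) \<subseteq> corners g" "\<Union>(face_z g b) \<subseteq> corners g"
    unfolding face_x_def face_y_def face_z_def cyc_Union corners_def by blast+
  consider "S = face_x g b" | "S = face_y g b" | "S = face_z g b"
    using assms(1) unfolding cube_faces_def by blast
  then show ?thesis
    by cases (use assms(2) c in \<open>simp_all only: subset_iff\<close>)
qed

text \<open>All readings of the edge set are covered, as in \<open>khexahedron\<close>; on distinct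
  vertices the right-hand side is the same for each of them.\<close>

definition face_root :: "('a \<Rightarrow> complex) \<Rightarrow> ('a set set \<Rightarrow> complex) \<Rightarrow> 'a set set \<Rightarrow> bool" where
  "face_root x y S \<longleftrightarrow> (\<forall>v1 v2 v3 v4. S = cyc v1 v2 v3 v4 \<longrightarrow> (y S)\<^sup>2 = x v1 * x v3 + x v2 * x v4)"

lemma face_rootI:
  assumes d: "distinct [a, b, c, d]" and y: "(y (cyc a b c d))\<^sup>2 = x a * x c + x b * x d"
  shows "face_root x y (cyc a b c d)"
  unfolding face_root_def
proof (intro allI impI)
  fix v1 v2 v3 v4 assume E: "cyc a b c d = cyc v1 v2 v3 v4"
  show "(y (cyc a b c d))\<^sup>2 = x v1 * x v3 + x v2 * x v4"
    using cyc_eqD[OF d E] unfolding y by (elim insertE) (simp_all add: algebra_simps)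
qed

text \<open>By \<open>face_root\<close>, every candidate for the choice in \<open>face_term\<close>
  equals the same square, so the choice is harmless.\<close>

lemma face_term_root:
  assumes "S = cyc a b c d" "v \<in> \<Union>S" "face_root x y S"
  shows "face_term x v S = (y S)\<^sup>2"
proof -
  have "\<exists>v1 v2 v3. S = cyc v v1 v2 v3"
  proof -
    have "S = cyc b c d a" "S = cyc c d a b" "S = cyc d a b c"
      unfolding assms(1) by (metis cyc_rotate)+
    moreover have "v \<in> {a, b, c, d}" using assms(2) unfolding assms(1) cyc_Union .
    ultimately show ?thesis using assms(1) by blast
  qed
  then obtain v1 v2 v3 where S: "S = cyc v v1 v2 v3" by blast
  show ?thesis unfolding face_term_def
  proof (rule some_equality)
    show "\<exists>v1 v2 v3. S = cyc v v1 v2 v3 \<and> (y S)\<^sup>2 = x v * x v2 + x v1 * x v3"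
      using S assms(3) unfolding face_root_def by blast
  next
    fix r assume "\<exists>v1 v2 v3. S = cyc v v1 v2 v3 \<and> r = x v * x v2 + x v1 * x v3"
    then obtain v1 v2 v3 where "S = cyc v v1 v2 v3" "r = x v * x v2 + x v1 * x v3" by blast
    then show "r = (y S)\<^sup>2" using assms(3) unfolding face_root_def by simp
  qed
qed

lemma KCv_eq:
  assumes "cube_inj g"
  shows "KCv g (g a b c) x = KC0 (\<lambda>i j k. g (i \<noteq> a) (j \<noteq> b) (k \<noteq> c)) x"
proof -
  have "(SOME p. (case p of (a', b', c') \<Rightarrow> g a' b' c' = g a b c)) = (a, b, c)"
    by (rule some_equality) (auto simp: cube_injD[OF assms])
  then show ?thesis by (simp add: KCv_def)
qed

text \<open>The K-hexahedron relations up to a sign \<open>u\<close>. For \<open>u = 1\<close> and a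
  nonzero bottom value they are \<open>khex_cube\<close>, with the equation for the top vertex
  rewritten through \<open>KC0\<close>.\<close>

definition signed_khex :: "(bool \<Rightarrow> bool \<Rightarrow> bool \<Rightarrow> 'a) \<Rightarrow> ('a \<Rightarrow> complex) \<Rightarrow> ('a set set \<Rightarrow> complex) \<Rightarrow> complex \<Rightarrow> bool" where
  "signed_khex g x y u \<longleftrightarrow> u * u = 1
     \<and> KC0 g x = u * y (face_x g False) * y (face_y g False) * y (face_z g False)
     \<and> y (face_x g True) = (u * y (face_y g False) * y (face_z g False) + y (face_x g False) * x (g True False False)) / x (g False False False)
     \<and> y (face_y g True) = (u * y (face_x g False) * y (face_z g False) + y (face_y g False) * x (g False True False)) / x (g False False False)
     \<and> y (face_z g True) = (u * y (face_x g False) * y (face_y g False) + y (face_z g False) * x (g False False True)) / x (g False False False)"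

text \<open>The condition \<open>a = b\<close> and \<open>b = c\<close> singles out the bottom and
  the top vertex. The three other conclusions are the root relations of the new faces, which let the
  propagation continue.\<close>

lemma signed_khex_vertex:
  assumes nz: "x (g False False False) \<noteq> 0" and h: "signed_khex g x y u"
    and lower: "\<And>S. S \<in> cube_faces g False \<Longrightarrow> face_root x y S"
  shows "KC0 (\<lambda>i j k. g (i \<noteq> a) (j \<noteq> b) (k \<noteq> c)) x
      = (if a = b \<and> b = c then 1 else - 1) * u * (y (face_x g a) * y (face_y g b) * y (face_z g c))" (is ?V)
    and "(y (face_x g True))\<^sup>2 = x (g True False False) * x (g True True True) + x (g True True False) * x (g True False True)"
    and "(y (face_y g True))\<^sup>2 = x (g False True False) * x (g True True True) + x (g True True False) * x (g False True True)"
    and "(y (face_z g True))\<^sup>2 = x (g False False True) * x (g True True True) + x (g True False True) * x (g False True True)"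
proof -
  define z where "z i j k = x (g i j k)" for i j k
  define X Y Z where "X b = y (face_x g b)" and "Y b = y (face_y g b)" and "Z b = y (face_z g b)" for b
  have roots: "(X False)\<^sup>2 = z False False False * z False True True + z False True False * z False False True"
    "(Y False)\<^sup>2 = z False False False * z True False True + z True False False * z False False True"
    "(Z False)\<^sup>2 = z False False False * z True True False + z True False False * z False True False"
    using lower[of "face_x g False"] lower[of "face_y g False"] lower[of "face_z g False"]
    by (simp_all add: cube_faces_def face_root_def face_x_def face_y_def face_z_def X_def Y_def Z_def z_def)
  have u: "u * u = 1"
    and K: "(z True True True * (z False False False)\<^sup>2
        - z False False False * (z True False False * z False True True + z False True False * z True False True
                                 + z False False True * z True True False)) / 2
      - z True False False * z False True False * z False False True = u * X False * Y False * Z False"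
    and X1: "X True = (u * Y False * Z False + X False * z True False False) / z False False False"
    and Y1: "Y True = (u * X False * Z False + Y False * z False True False) / z False False False"
    and Z1: "Z True = (u * X False * Y False + Z False * z False False True) / z False False False"
    using h by (simp_all add: signed_khex_def KC0_def z_def X_def Y_def Z_def Let_def)
  have nz': "z False False False \<noteq> 0" using nz by (simp add: z_def)
  note r = roots(1) roots(2) roots(3)
  have r': "(X False)\<^sup>2 = z False False False * z False True True + z False False True * z False True False"
    "(Y False)\<^sup>2 = z False False False * z True False True + z False False True * z True False False"
    "(Z False)\<^sup>2 = z False False False * z True True False + z False True False * z True False False"
    using roots by (simp_all add: mult.commute)
  note xyz = cube_signed[OF nz' r(1) r(2) r(3) u K X1 Y1 Z1]
  have Ky: "(z True True True * (z False False False)\<^sup>2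
        - z False False False * (z False True False * z True False True + z True False False * z False True True
                                 + z False False True * z True True False)) / 2
      - z False True False * z True False False * z False False True = u * Y False * X False * Z False"
    and Kz: "(z True True True * (z False False False)\<^sup>2
        - z False False False * (z False False True * z True True False + z False True False * z True False True
                                 + z True False False * z False True True)) / 2
      - z False False True * z False True False * z True False False = u * Z False * Y False * X False"
    and Kx: "(z True True True * (z False False False)\<^sup>2
        - z False False False * (z True False False * z False True True + z False False True * z True True False
                                 + z False True False * z True False True)) / 2
      - z True False False * z False False True * z False True False = u * X False * Z False * Y False"
    using K by (simp_all add: ac_simps)
  have c: "X True = (u * Z False * Y False + X False * z True False False) / z False False False"
    "Y True = (u * Z False * X False + Y False * z False True False) / z False False False"
    "Z True = (u * Y False * X False + Z False * z False False True) / z False False False"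
    using X1 Y1 Z1 by (simp_all add: ac_simps)
  \<comment> \<open>Exchanging two axes reaches the missing vertices: \<open>yxz\<close> treats 010,
    \<open>zyx\<close> treats 001 and 011, and \<open>xzy\<close> treats 101.\<close>
  note yxz = cube_signed[OF nz' r(2) r(1) r'(3) u Ky Y1 X1 c(3)]
  note zyx = cube_signed[OF nz' r'(3) r'(2) r'(1) u Kz c(3) c(2) c(1)]
  note xzy = cube_signed[OF nz' r'(1) r(3) r(2) u Kx c(1) Z1 Y1]
  have eqs: "(Y True)\<^sup>2 = z False True False * z True True True + z True True False * z False True True"
    "(z True False True * (z False True False)\<^sup>2 - z False True False * (z False False False * z True True True + z True True False * z False False True + z False True True * z True False False)) / 2
      - z False False False * z True True False * z False True True = - (u * Y True * X False * Z False)"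
    "(Z True)\<^sup>2 = z False False True * z True True True + z False True True * z True False True"
    "(z True True False * (z False False True)\<^sup>2 - z False False True * (z False False False * z True True True + z False True True * z True False False + z True False True * z False True False)) / 2
      - z False False False * z False True True * z True False True = - (u * Z True * Y False * X False)"
    "(z True False False * (z False True True)\<^sup>2 - z False True True * (z False True False * z True False True + z False False True * z True True False + z True True True * z False False False)) / 2
      - z False True False * z False False True * z True True True = - (u * Z True * Y True * X False)"
    "(z False True False * (z True False True)\<^sup>2 - z True False True * (z False False True * z True True False + z True False False * z False True True + z True True True * z False False False)) / 2
      - z False False True * z True False False * z True True True = - (u * X True * Z True * Y False)"
    by (rule yxz(1,2) zyx(1,2,3) xzy(3))+
  show ?V
    unfolding KC0_def Let_def X_def[symmetric] Y_def[symmetric] Z_def[symmetric] z_def[symmetric]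
    using xyz(2,3,4) eqs(2,4,5,6) K
    by (cases a; cases b; cases c) (simp_all add: ac_simps)
  show "(y (face_x g True))\<^sup>2 = x (g True False False) * x (g True True True) + x (g True True False) * x (g True False True)"
    using xyz(1) by (simp add: X_def z_def)
  show "(y (face_y g True))\<^sup>2 = x (g False True False) * x (g True True True) + x (g True True False) * x (g False True True)"
    using eqs(1) by (simp add: Y_def z_def)
  show "(y (face_z g True))\<^sup>2 = x (g False False True) * x (g True True True) + x (g True False True) * x (g False True True)"
    using eqs(3) by (simp add: Z_def z_def mult.commute)
qed

text \<open>Four times the square of \<open>KC0\<close> differs from four times the product of the
  face terms by \<open>KC\<close> times the squared bottom value. This is where the Kashaev equation
  leaves only a sign undetermined.\<close>

lemma KC0_square:
  assumes "KC g x = 0"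
  shows "(KC0 g x)\<^sup>2 = (x (g False False False) * x (g False True True) + x (g False True False) * x (g False False True))
    * (x (g False False False) * x (g True False True) + x (g True False False) * x (g False False True))
    * (x (g False False False) * x (g True True False) + x (g True False False) * x (g False True False))"
proof -
  have "4 * (KC0 g x)\<^sup>2 = (x (g False False False))\<^sup>2 * KC g x
    + 4 * ((x (g False False False) * x (g False True True) + x (g False True False) * x (g False False True))
    * (x (g False False False) * x (g True False True) + x (g True False False) * x (g False False True))
    * (x (g False False False) * x (g True True False) + x (g True False False) * x (g False True False)))"
    unfolding KC0_def KC_def Let_def by (simp add: power2_eq_square field_simps)
  then show ?thesis using assms by simp
qed

section \<open>Combinatorics of piles\<close>

lemma flipD:
  assumes "flip T T' w h v"
  shows "cyc w (h 1) (h 2) (h 3) \<in> T" "cyc w (h 3) (h 4) (h 5) \<in> T" "cyc w (h 5) (h 6) (h 1) \<in> T"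
    and "cyc v (h 2) (h 3) (h 4) \<in> T'" "cyc v (h 4) (h 5) (h 6) \<in> T'" "cyc v (h 6) (h 1) (h 2) \<in> T'"
proof -
  note f = assms[unfolded flip_def]
  show "cyc w (h 1) (h 2) (h 3) \<in> T" "cyc w (h 3) (h 4) (h 5) \<in> T" "cyc w (h 5) (h 6) (h 1) \<in> T"
    using f by blast+
  have "T' = (T - {cyc w (h 1) (h 2) (h 3), cyc w (h 3) (h 4) (h 5), cyc w (h 5) (h 6) (h 1)})
           \<union> {cyc v (h 2) (h 3) (h 4), cyc v (h 4) (h 5) (h 6), cyc v (h 6) (h 1) (h 2)}"
    using f by (elim conjE)
  then show "cyc v (h 2) (h 3) (h 4) \<in> T'" "cyc v (h 4) (h 5) (h 6) \<in> T'" "cyc v (h 6) (h 1) (h 2) \<in> T'"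
    by (simp_all only: Un_iff insert_iff simp_thms)
qed

text \<open>Vertices of a single quadrilateral are distinct, which leaves only the antipodal pairs
  of the hexagon. If such a pair coincided, two different old quadrilaterals would share three
  noncollinear vertices.\<close>

lemma flip_distinct:
  assumes T: "quadrangulation R T" and T': "quadrangulation R' T'" and f: "flip T T' w h v"
  shows "distinct [w, h 1, h 2, h 3, h 4, h 5, h 6]" and "v \<notin> {h 1, h 2, h 3, h 4, h 5, h 6}"
proof -
  let ?Q1 = "cyc w (h 1) (h 2) (h 3)" and ?Q2 = "cyc w (h 3) (h 4) (h 5)" and ?Q3 = "cyc w (h 5) (h 6) (h 1)"
  note Q = flipD(1-3)[OF f]
  note q = Q[THEN quadrangulation_is_quad[OF T], THEN is_quad_conds]
  note q' = flipD(4-6)[OF f, THEN quadrangulation_is_quad[OF T'], THEN is_quad_conds]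
  note d = q[unfolded quad_conds_def, THEN conjunct1] q'[unfolded quad_conds_def, THEN conjunct1]
  have dd: "w \<noteq> h 1" "w \<noteq> h 2" "w \<noteq> h 3" "w \<noteq> h 5" "w \<noteq> h 6" "h 1 \<noteq> h 3" "h 1 \<noteq> h 5" "h 3 \<noteq> h 5"
    using d(1-3) by auto
  have ne: "?Q1 \<noteq> ?Q2" "?Q3 \<noteq> ?Q1"
  proof -
    have False if "?Q1 = ?Q2" using cyc_eqD[OF d(1) that] dd by (elim insertE) simp_all
    then show "?Q1 \<noteq> ?Q2" by (rule notI)
    have False if "?Q3 = ?Q1" using cyc_eqD[OF d(3) that] dd by (elim insertE) simp_all
    then show "?Q3 \<noteq> ?Q1" by (rule notI)
  qed
  have "h 4 \<noteq> h 1"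
  proof
    assume "h 4 = h 1"
    then have "collinear {h 3, w, h 1}"
      by (intro common_vertices_collinear[OF T Q(1,2) ne(1)]) (auto simp: qverts_def)
    then show False using q(1) by (simp add: quad_conds_def)
  qed
  moreover have "h 5 \<noteq> h 2"
  proof
    assume "h 5 = h 2"
    then have "collinear {h 2, h 3, w}"
      by (intro common_vertices_collinear[OF T Q(1,2) ne(1)]) (auto simp: qverts_def)
    then show False using q(1) by (simp add: quad_conds_def)
  qed
  moreover have "h 6 \<noteq> h 3"
  proof
    assume "h 6 = h 3"
    then have "collinear {h 3, w, h 1}"
      by (intro common_vertices_collinear[OF T Q(3,1) ne(2)]) (auto simp: qverts_def)
    then show False using q(1) by (simp add: quad_conds_def)
  qed
  ultimately show "distinct [w, h 1, h 2, h 3, h 4, h 5, h 6]" "v \<notin> {h 1, h 2, h 3, h 4, h 5, h 6}"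
    using d by auto
qed

lemma flip_new_vertex:
  assumes T: "quadrangulation R T" and T': "quadrangulation R' T'" and f: "flip T T' w h v"
    and E: "E \<in> T'" "v \<in> qverts E"
  shows "E \<in> {cyc v (h 2) (h 3) (h 4), cyc v (h 4) (h 5) (h 6), cyc v (h 6) (h 1) (h 2)}"
proof (rule surrounded_vertex[OF T' flipD(4-6)[OF f] _ _ _ E])
  note d = flip_distinct[OF T T' f]
  have U: "\<Union>(cyc v (h 2) (h 3) (h 4)) \<noteq> \<Union>(cyc v (h 4) (h 5) (h 6))"
    "\<Union>(cyc v (h 4) (h 5) (h 6)) \<noteq> \<Union>(cyc v (h 6) (h 1) (h 2))"
    "\<Union>(cyc v (h 2) (h 3) (h 4)) \<noteq> \<Union>(cyc v (h 6) (h 1) (h 2))"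
    using d by (auto simp: set_eq_iff)
  then show "cyc v (h 2) (h 3) (h 4) \<noteq> cyc v (h 4) (h 5) (h 6)"
    "cyc v (h 4) (h 5) (h 6) \<noteq> cyc v (h 6) (h 1) (h 2)"
    "cyc v (h 2) (h 3) (h 4) \<noteq> cyc v (h 6) (h 1) (h 2)" by metis+
qed

lemma qverts_cyc [simp]: "qverts (cyc a b c d) = {a, b, c, d}"
  by (simp add: qverts_def)

lemma fst_vlab [simp]: "fst (vlab fv i p) = p"
  by (induction i) auto

lemma snd_vlab_le: "snd (vlab fv i p) \<le> i"
  by (induction i) (auto intro: le_SucI)

lemma vlab_eq_iff [simp]: "vlab fv i p = vlab fv i q \<longleftrightarrow> p = q"
  by (metis fst_vlab)

lemma vlab_pred: "0 < i \<Longrightarrow> p \<noteq> fv i \<Longrightarrow> vlab fv i p = vlab fv (i - 1) p"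
  by (cases i) auto

lemma vlab_new: "0 < i \<Longrightarrow> vlab fv i (fv i) = (fv i, i)"
  by (cases i) auto

lemma lab_face_cyc: "lab_face fv i (cyc a b c d) = cyc (vlab fv i a) (vlab fv i b) (vlab fv i c) (vlab fv i d)"
  by (simp add: lab_face_def cyc_def)

lemma Union_lab_face: "\<Union>(lab_face fv i E) = vlab fv i ` qverts E"
  by (auto simp: lab_face_def qverts_def)

section \<open>Creation and removal of faces in a fixed pile\<close>

context
  fixes Ts :: "nat \<Rightarrow> pt set set set" and l :: nat
    and fw fv :: "nat \<Rightarrow> pt" and fh :: "nat \<Rightarrow> nat \<Rightarrow> pt"
  assumes pile: "pile Ts l fw fh fv"
begin

abbreviation cube :: "nat \<Rightarrow> bool \<Rightarrow> bool \<Rightarrow> bool \<Rightarrow> kv" where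
  "cube \<equiv> kcube fw fh fv"

abbreviation bottom_quads :: "nat \<Rightarrow> pt set set set" where
  "bottom_quads i \<equiv> {cyc (fw i) (fh i 1) (fh i 2) (fh i 3), cyc (fw i) (fh i 3) (fh i 4) (fh i 5),
     cyc (fw i) (fh i 5) (fh i 6) (fh i 1)}"

abbreviation top_quads :: "nat \<Rightarrow> pt set set set" where
  "top_quads i \<equiv> {cyc (fv i) (fh i 2) (fh i 3) (fh i 4), cyc (fv i) (fh i 4) (fh i 5) (fh i 6),
     cyc (fv i) (fh i 6) (fh i 1) (fh i 2)}"

lemma quadrangulation_Ts: "\<exists>R. \<forall>i\<le>l. quadrangulation R (Ts i)"
  using pile[unfolded pile_def, THEN conjunct1] by (elim exE conjE) (rule exI)

lemma flip_Ts: "i \<in> {1..l} \<Longrightarrow> flip (Ts (i - 1)) (Ts i) (fw i) (fh i) (fv i)"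
  using pile[unfolded pile_def, THEN conjunct2] by (rule bspec)

lemma is_quad_Ts:
  assumes "i \<le> l" "E \<in> Ts i"
  shows "is_quad E"
proof -
  obtain R where "\<forall>i\<le>l. quadrangulation R (Ts i)" using quadrangulation_Ts ..
  then have "quadrangulation R (Ts i)" using assms(1) by simp
  then show ?thesis using assms(2) by (rule quadrangulation_is_quad)
qed

lemma hexagon_distinct:
  assumes "i \<in> {1..l}"
  shows "distinct [fw i, fh i 1, fh i 2, fh i 3, fh i 4, fh i 5, fh i 6]"
    and "fv i \<notin> {fh i 1, fh i 2, fh i 3, fh i 4, fh i 5, fh i 6}"
proof -
  obtain R where R: "\<forall>i\<le>l. quadrangulation R (Ts i)" using quadrangulation_Ts ..
  have T: "quadrangulation R (Ts (i - 1))" "quadrangulation R (Ts i)"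
    using assms by (auto intro!: R[rule_format] simp del: One_nat_def)
  show "distinct [fw i, fh i 1, fh i 2, fh i 3, fh i 4, fh i 5, fh i 6]"
    "fv i \<notin> {fh i 1, fh i 2, fh i 3, fh i 4, fh i 5, fh i 6}"
    by (rule flip_distinct[OF T flip_Ts[OF assms]])+
qed

lemma new_vertex_quads:
  assumes "i \<in> {1..l}" "E \<in> Ts i" "fv i \<in> qverts E"
  shows "E \<in> top_quads i"
proof -
  obtain R where R: "\<forall>i\<le>l. quadrangulation R (Ts i)" using quadrangulation_Ts ..
  have T: "quadrangulation R (Ts (i - 1))" "quadrangulation R (Ts i)"
    using assms by (auto intro!: R[rule_format] simp del: One_nat_def)
  show ?thesis by (rule flip_new_vertex[OF T flip_Ts[OF assms(1)] assms(2,3)])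
qed

lemma bottom_quads_subset:
  assumes "i \<in> {1..l}"
  shows "bottom_quads i \<subseteq> Ts (i - 1)"
  using flipD(1-3)[OF flip_Ts[OF assms]] by simp

lemma Ts_step:
  assumes "i \<in> {1..l}"
  shows "Ts i = (Ts (i - 1) - bottom_quads i) \<union> top_quads i"
  using flip_Ts[OF assms] unfolding flip_def by (elim conjE)

lemma bottom_vertex_quads:
  assumes "i \<in> {1..l}" "E \<in> Ts (i - 1)" "fw i \<in> qverts E"
  shows "E \<in> bottom_quads i"
proof -
  have "\<forall>E\<in>Ts (i - 1). fw i \<in> qverts E \<longrightarrow> E \<in> bottom_quads i"
    using flip_Ts[OF assms(1)] unfolding flip_def by (elim conjE)
  then have "fw i \<in> qverts E \<longrightarrow> E \<in> bottom_quads i" using assms(2) by (rule bspec)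
  then show ?thesis using assms(3) by (rule mp)
qed

lemma kcube_simps:
  "cube i False False False = vlab fv (i - 1) (fw i)"
  "cube i True False False = vlab fv (i - 1) (fh i 1)"
  "cube i True True False = vlab fv (i - 1) (fh i 2)"
  "cube i False True False = vlab fv (i - 1) (fh i 3)"
  "cube i False True True = vlab fv (i - 1) (fh i 4)"
  "cube i False False True = vlab fv (i - 1) (fh i 5)"
  "cube i True False True = vlab fv (i - 1) (fh i 6)"
  "cube i True True True = (fv i, i)"
  by (simp_all add: kcube_def)

lemma vlab_neq_new: "i \<in> {1..l} \<Longrightarrow> vlab fv (i - 1) p \<noteq> (q, i)"
  using snd_vlab_le[of fv "i - 1" p] by (cases i) auto

lemma cube_inj_kcube:
  assumes "i \<in> {1..l}"
  shows "cube_inj (cube i)"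
proof -
  have N: "snd (vlab fv (i - 1) p) \<noteq> i" for p
    using snd_vlab_le[of fv "i - 1" p] assms by auto
  \<comment> \<open>A left inverse of the labelling. The index is tested first because
    \<open>fv i\<close> and \<open>fw i\<close> may be the same point of the plane; only the index
    separates top from bottom.\<close>
  define dec where "dec v = (if snd v = i then (True, True, True) else if fst v = fw i then (False, False, False)
    else if fst v = fh i 1 then (True, False, False) else if fst v = fh i 2 then (True, True, False)
    else if fst v = fh i 3 then (False, True, False) else if fst v = fh i 4 then (False, True, True)
    else if fst v = fh i 5 then (False, False, True) else (True, False, True))" for v :: kv
  have "dec (cube i a b c) = (a, b, c)" for a b c
    using hexagon_distinct(1)[OF assms] N
    by (cases a; cases b; cases c) (auto simp: dec_def kcube_simps)
  then have "(a, b, c) = (a', b', c')" if "cube i a b c = cube i a' b' c'" for a b c a' b' c'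
    using that by metis
  then show ?thesis unfolding cube_inj_def by blast
qed

lemma lower_faces:
  "cube_faces (cube i) False = lab_face fv (i - 1) ` bottom_quads i"
  by (simp add: cube_faces_def face_x_def face_y_def face_z_def kcube_simps lab_face_cyc)
     (auto simp: cyc_def insert_commute)

text \<open>The hexagon vertices differ from \<open>fv i\<close>, so flip \<open>i\<close> does not
  change their labels.\<close>

lemma upper_faces:
  assumes "i \<in> {1..l}"
  shows "cube_faces (cube i) True = lab_face fv i ` top_quads i"
proof -
  have "vlab fv i p = vlab fv (i - 1) p" if "p \<in> {fh i 1, fh i 2, fh i 3, fh i 4, fh i 5, fh i 6}" for p
    using that hexagon_distinct(2)[OF assms] assms by (intro vlab_pred) auto
  moreover have "vlab fv i (fv i) = (fv i, i)" using assms by (intro vlab_new) auto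
  ultimately show ?thesis
    by (simp add: cube_faces_def face_x_def face_y_def face_z_def kcube_simps lab_face_cyc)
       (auto simp: cyc_def insert_commute)
qed

lemma kfaces_eq: "m \<le> l \<Longrightarrow> kfaces Ts m fh fv = lab_face fv 0 ` Ts 0 \<union> (\<Union>i\<in>{1..m}. cube_faces (cube i) True)"
  unfolding kfaces_def using upper_faces by auto

lemma kfaces_mono: "m \<le> n \<Longrightarrow> n \<le> l \<Longrightarrow> kfaces Ts m fh fv \<subseteq> kfaces Ts n fh fv"
  by (fastforce simp: kfaces_eq)

text \<open>A quadrilateral surviving a flip keeps its labels because the new vertex lies on none of
  the survivors; this is the use of planarity.\<close>

lemma lab_face_in_kfaces: "m \<le> l \<Longrightarrow> E \<in> Ts m \<Longrightarrow> lab_face fv m E \<in> kfaces Ts m fh fv"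
proof (induction m arbitrary: E)
  case 0
  then show ?case by (simp add: kfaces_eq)
next
  case (Suc m)
  then have i: "Suc m \<in> {1..l}" by simp
  show ?case
  proof (cases "E \<in> top_quads (Suc m)")
    case True
    then have "lab_face fv (Suc m) E \<in> cube_faces (cube (Suc m)) True"
      unfolding upper_faces[OF i] by blast
    then show ?thesis using Suc.prems(1) by (subst kfaces_eq) auto
  next
    case False
    then have E: "E \<in> Ts m" using Ts_step[OF i] Suc.prems(2) by auto
    have "fv (Suc m) \<notin> qverts E" using new_vertex_quads[OF i Suc.prems(2)] False by blast
    then have "vlab fv (Suc m) ` e = vlab fv m ` e" if "e \<in> E" for e
      using that by (intro image_cong) (auto simp: qverts_def)
    then have "lab_face fv (Suc m) E = lab_face fv m E"
      by (auto simp: lab_face_def)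
    then show ?thesis using Suc E kfaces_mono[of m "Suc m"] by auto
  qed
qed

lemma lower_faces_subset: "i \<in> {1..l} \<Longrightarrow> cube_faces (cube i) False \<subseteq> kfaces Ts (i - 1) fh fv"
  using lab_face_in_kfaces[of "i - 1"] bottom_quads_subset[of i] unfolding lower_faces by fastforce

lemma upper_faces_subset: "i \<in> {1..l} \<Longrightarrow> cube_faces (cube i) True \<subseteq> kfaces Ts i fh fv"
  by (auto simp: kfaces_eq)

lemma cube_faces_subset: "i \<in> {1..l} \<Longrightarrow> cube_faces (cube i) b \<subseteq> kfaces Ts l fh fv"
  using lower_faces_subset[of i] upper_faces_subset[of i] kfaces_mono[of "i - 1" l] diff_le_self[of i 1, THEN order_trans, of l] kfaces_mono[of i l]
  by (cases b) auto

lemma top_in_upper: "S \<in> cube_faces (cube i) True \<Longrightarrow> (fv i, i) \<in> \<Union>S"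
  by (auto simp: cube_faces_def face_x_def face_y_def face_z_def kcube_simps simp del: Union_iff)

lemma bottom_in_lower: "S \<in> cube_faces (cube i) False \<Longrightarrow> cube i False False False \<in> \<Union>S"
  by (auto simp: cube_faces_def face_x_def face_y_def face_z_def simp del: Union_iff)

lemma kface_index_le:
  assumes "m \<le> l" "S \<in> kfaces Ts m fh fv" "q \<in> \<Union>S"
  shows "snd q \<le> m"
proof -
  obtain i E where "i \<le> m" "S = lab_face fv i E"
  proof (cases "S \<in> lab_face fv 0 ` Ts 0")
    case True
    then show ?thesis using that[of 0] by blast
  next
    case False
    then obtain i where "i \<in> {1..m}" "S \<in> cube_faces (cube i) True"
      using assms(2) kfaces_eq[OF assms(1)] by auto
    then show ?thesis using that upper_faces[of i] assms(1) by auto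
  qed
  moreover then obtain p where "q = vlab fv i p" using assms(3) by (auto simp only: Union_lab_face)
  ultimately show ?thesis using snd_vlab_le[of fv i p] by simp
qed

text \<open>The index of a vertex is its time of creation, so a face with top vertex
  \<open>(fv i, i)\<close> cannot occur before flip \<open>i\<close>. This orders the cubes around a
  face in time.\<close>

lemma top_index_le:
  assumes "m \<le> l" "S \<in> cube_faces (cube i) True" "S \<in> kfaces Ts m fh fv"
  shows "i \<le> m"
  using kface_index_le[OF assms(1,3) top_in_upper[OF assms(2)]] by simp

lemma upper_unique:
  assumes "i \<in> {1..l}" "j \<in> {1..l}" "S \<in> cube_faces (cube i) True" "S \<in> cube_faces (cube j) True"
  shows "i = j"
proof (rule antisym)
  show "i \<le> j" using assms upper_faces_subset[OF assms(2)] by (intro top_index_le[OF _ assms(3)]) auto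
  show "j \<le> i" using assms upper_faces_subset[OF assms(1)] by (intro top_index_le[OF _ assms(4)]) auto
qed

lemma upper_lower_less:
  assumes "i \<in> {1..l}" "j \<in> {1..l}" "S \<in> cube_faces (cube i) True" "S \<in> cube_faces (cube j) False"
  shows "i < j"
proof -
  have "i \<le> j - 1"
    using assms lower_faces_subset[OF assms(2)] by (intro top_index_le[OF _ assms(3)]) auto
  then show ?thesis using assms(2) by auto
qed

lemma vertex_step:
  assumes m: "Suc m \<in> {1..l}" and E: "E \<in> Ts (Suc m)" "p \<in> qverts E" and ne: "p \<noteq> fv (Suc m)"
  shows "\<exists>E'\<in>Ts m. p \<in> qverts E'"
proof (cases "E \<in> top_quads (Suc m)")
  case True
  then have "p \<in> {fh (Suc m) 1, fh (Suc m) 2, fh (Suc m) 3, fh (Suc m) 4, fh (Suc m) 5, fh (Suc m) 6}"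
    using E(2) ne by auto
  then have "\<exists>E'\<in>bottom_quads (Suc m). p \<in> qverts E'"
    unfolding bex_simps qverts_cyc insert_iff by blast
  then obtain E' where "E' \<in> bottom_quads (Suc m)" "p \<in> qverts E'" ..
  then show ?thesis using subsetD[OF bottom_quads_subset[OF m]] by auto
next
  case False
  then have "E \<in> Ts (Suc m - 1)" using E(1) unfolding Ts_step[OF m] by blast
  then show ?thesis using E(2) by auto
qed

text \<open>After flip \<open>i\<close> the point \<open>fw i\<close> can reappear only as the new
  vertex of that flip or a later one, and then it carries a larger index than the removed
  label.\<close>

lemma bottom_gone:
  assumes i: "i \<in> {1..l}" and "i \<le> m" "m \<le> l" "E \<in> Ts m"
  shows "cube i False False False \<notin> \<Union>(lab_face fv m E)"
proof -
  \<comment> \<open>The label equation says that the point still carries its old label; this weaker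
    condition on \<open>fw i\<close> is what survives the induction over later flips.\<close>
  have gone: "\<not> (E \<in> Ts m \<and> fw i \<in> qverts E \<and> vlab fv m (fw i) = vlab fv (i - 1) (fw i))" for E
    using assms(2,3)
  proof (induction m arbitrary: E rule: dec_induct)
    case base
    show ?case
    proof safe
      assume E: "E \<in> Ts i" "fw i \<in> qverts E" "vlab fv i (fw i) = vlab fv (i - 1) (fw i)"
      have "fw i \<noteq> fv i"
        using E(3) vlab_new[of i fv] vlab_neq_new[OF i] i by (metis atLeastAtMost_iff less_eq_Suc_le One_nat_def)
      then have "E \<notin> top_quads i" using E(2) hexagon_distinct(1)[OF i] by auto
      then have "E \<in> Ts (i - 1) - bottom_quads i" using E(1) unfolding Ts_step[OF i] by blast
      then show False using bottom_vertex_quads[OF i _ E(2)] by blast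
    qed
  next
    case (step m)
    then have m: "Suc m \<in> {1..l}" by simp
    show ?case
    proof safe
      assume E: "E \<in> Ts (Suc m)" "fw i \<in> qverts E" "vlab fv (Suc m) (fw i) = vlab fv (i - 1) (fw i)"
      have ne: "fw i \<noteq> fv (Suc m)"
        using arg_cong[OF E(3), of snd] snd_vlab_le[of fv "i - 1" "fw i"] step(1) by (auto split: if_splits)
      then have "\<exists>E'\<in>Ts m. fw i \<in> qverts E'" by (rule vertex_step[OF m E(1,2)])
      then show False using step.IH step.prems E(3) ne by auto
    qed
  qed
  show ?thesis
  proof
    assume "cube i False False False \<in> \<Union>(lab_face fv m E)"
    then obtain x where x: "x \<in> qverts E" "vlab fv (i - 1) (fw i) = vlab fv m x"
      unfolding Union_lab_face kcube_simps by blast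
    then have "x = fw i" by (metis fst_vlab)
    then show False using x gone[of E] assms(4) by simp
  qed
qed

text \<open>For \<open>i < j\<close>, a lower face of cube \<open>j\<close> is still present just
  before flip \<open>j\<close>, whereas one of cube \<open>i\<close> contains a label already gone
  by then.\<close>

lemma lower_unique:
  assumes "i \<in> {1..l}" "j \<in> {1..l}" "S \<in> cube_faces (cube i) False" "S \<in> cube_faces (cube j) False"
  shows "i = j"
proof -
  have "\<not> i < j" if h: "i \<in> {1..l}" "j \<in> {1..l}" "S \<in> cube_faces (cube i) False" "S \<in> cube_faces (cube j) False" for i j
  proof
    assume "i < j"
    obtain E where "E \<in> Ts (j - 1)" "S = lab_face fv (j - 1) E"
      using h(4) bottom_quads_subset[OF h(2)] unfolding lower_faces by blast
    then show False
      using bottom_gone[OF h(1), of "j - 1" E] bottom_in_lower[OF h(3)] h(2) \<open>i < j\<close> \<open>E \<in> Ts (j - 1)\<close> \<open>S = lab_face fv (j - 1) E\<close>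
      by (metis One_nat_def Suc_pred atLeastAtMost_iff diff_le_self le_trans less_Suc_eq_le less_eq_Suc_le)
  qed
  then show ?thesis using assms by (meson linorder_neqE_nat)
qed

lemma kface_lab:
  assumes "S \<in> kfaces Ts l fh fv"
  obtains m E where "m \<le> l" "E \<in> Ts m" "S = lab_face fv m E"
proof (cases "S \<in> lab_face fv 0 ` Ts 0")
  case True
  then show ?thesis using that[of 0] by blast
next
  case False
  then obtain i where i: "i \<in> {1..l}" "S \<in> cube_faces (cube i) True"
    using assms kfaces_eq[OF order_refl] by auto
  then obtain E where "E \<in> top_quads i" "S = lab_face fv i E" unfolding upper_faces[OF i(1)] by blast
  then show ?thesis using that[of i E] Ts_step[OF i(1)] i(1) by auto
qed

lemma kface_cyc:
  assumes "S \<in> kfaces Ts l fh fv"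
  obtains a b c d where "S = cyc a b c d" "distinct [a, b, c, d]"
proof -
  obtain m E where m: "m \<le> l" "E \<in> Ts m" "S = lab_face fv m E" using assms by (rule kface_lab)
  then obtain a b c d where E: "E = cyc a b c d" by (meson is_quad_Ts is_quad_def)
  then have "distinct [a, b, c, d]"
    using is_quad_conds[of a b c d] is_quad_Ts[OF m(1,2)] unfolding quad_conds_def by simp
  then show thesis
    using that[of "vlab fv m a" "vlab fv m b" "vlab fv m c" "vlab fv m d"] m E by (simp add: lab_face_cyc)
qed

lemma kface_verts:
  assumes "S \<in> kfaces Ts l fh fv" "q \<in> \<Union>S"
  shows "q \<in> kverts Ts l fv"
proof -
  have "vlab fv m p \<in> kverts Ts l fv" if "m \<le> l" "E \<in> Ts m" "p \<in> qverts E" for m E p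
    using that
  proof (induction m arbitrary: E)
    case 0
    then show ?case by (auto simp: kverts_def)
  next
    case (Suc m)
    then have i: "Suc m \<in> {1..l}" by simp
    show ?case
    proof (cases "p = fv (Suc m)")
      case True
      then show ?thesis using i by (auto simp: kverts_def)
    next
      case False
      then have "\<exists>E'\<in>Ts m. p \<in> qverts E'" by (rule vertex_step[OF i Suc.prems(2,3)])
      then show ?thesis using Suc False by auto
    qed
  qed
  moreover obtain m E where "m \<le> l" "E \<in> Ts m" "S = lab_face fv m E" using assms(1) by (rule kface_lab)
  ultimately show ?thesis using assms(2) by (auto simp: Union_lab_face)
qed

section \<open>Coherent solutions\<close>

lemma realization_eq:
  "realization Ts l fw fh fv = (\<Union>F\<in>kfaces Ts l fh fv. square_cell F) \<union> (\<Union>i\<in>{1..l}. cube_cell (cube i))"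
  unfolding realization_def square_cell_def cube_cell_def ..

text \<open>Two different cubes contain the face; uniqueness forbids that it is upper in both or
  lower in both.\<close>

lemma interior_face_upper_lower:
  assumes v: "interior_vertex Ts l fw fh fv v" and S: "S \<in> kfaces Ts l fh fv" "v \<in> \<Union>S"
  obtains i j where "i \<in> {1..l}" "S \<in> cube_faces (cube i) True" "j \<in> {1..l}" "S \<in> cube_faces (cube j) False"
proof -
  obtain a b c d where abcd: "S = cyc a b c d" "distinct [a, b, c, d]" using S(1) by (rule kface_cyc)
  have "v \<in> {a, b, c, d}" using S(2) unfolding abcd(1) cyc_Union .
  moreover have "S = cyc b c d a" "S = cyc c d a b" "S = cyc d a b c"
    unfolding abcd(1) by (metis cyc_rotate)+
  moreover have "distinct [b, c, d, a]" "distinct [c, d, a, b]" "distinct [d, a, b, c]" using abcd(2) by auto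
  ultimately obtain p q r where S': "S = cyc v p q r" "distinct [v, p, q, r]" using abcd by blast
  obtain U and c0 :: "real ^ 3" and r0 where U: "openin (top_of_set (realization Ts l fw fh fv)) U"
    "(\<lambda>u. if u = v then 1 else 0) \<in> U" "U homeomorphic ball c0 r0"
    using v unfolding interior_vertex_def by blast
  have "\<exists>i\<in>{1..l}. \<exists>j\<in>{1..l}. i \<noteq> j \<and> cyc v p q r \<in> cube_faces (cube i) False \<union> cube_faces (cube i) True
    \<and> cyc v p q r \<in> cube_faces (cube j) False \<union> cube_faces (cube j) True"
    by (rule interior_face_two_cubes[OF _ _ realization_eq _ S'(2) U])
       (use S(1) S'(1) cube_inj_kcube in auto)
  then obtain i j where ij: "i \<in> {1..l}" "j \<in> {1..l}" "i \<noteq> j"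
    "S \<in> cube_faces (cube i) False \<union> cube_faces (cube i) True"
    "S \<in> cube_faces (cube j) False \<union> cube_faces (cube j) True"
    unfolding S'(1) by blast
  consider "S \<in> cube_faces (cube i) False" "S \<in> cube_faces (cube j) True"
    | "S \<in> cube_faces (cube i) True" "S \<in> cube_faces (cube j) False"
    using ij upper_unique[OF ij(1,2)] lower_unique[OF ij(1,2)] by blast
  then show thesis using that[of i j] that[of j i] ij(1,2) by cases
qed

lemma finite_kfaces: "finite (kfaces Ts l fh fv)"
proof -
  obtain R where "\<forall>i\<le>l. quadrangulation R (Ts i)" using quadrangulation_Ts ..
  then have "quadrangulation R (Ts 0)" by simp
  then have "finite (Ts 0)" by (simp add: quadrangulation_def)
  then show ?thesis by (simp add: kfaces_def)
qed

lemma finite_cube_faces: "finite (cube_faces g b)"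
  by (simp add: cube_faces_def)

text \<open>For either value of \<open>b\<close>, the sets \<open>A b i\<close> partition the faces
  at \<open>v\<close>: they cover since each face is both an upper and a lower one, and they are
  disjoint by uniqueness. The two partitions give the square.\<close>

lemma prod_cubes_at_faces:
  fixes f :: "kv set set \<Rightarrow> 'b :: comm_semiring_1"
  assumes v: "interior_vertex Ts l fw fh fv v"
  shows "(\<Prod>i\<in>cubes_at fw fh fv l v. \<Prod>S\<in>{S \<in> cube_faces (cube i) False \<union> cube_faces (cube i) True. v \<in> \<Union>S}. f S)
    = (\<Prod>S\<in>{S \<in> kfaces Ts l fh fv. v \<in> \<Union>S}. (f S)\<^sup>2)"
proof -
  define A where "A b i = {S \<in> cube_faces (cube i) b. v \<in> \<Union>S}" for b i
  define I where "I = cubes_at fw fh fv l v"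
  have I: "I \<subseteq> {1..l}" "finite I" unfolding I_def cubes_at_def by auto
  have fin: "finite (A b i)" for b i by (simp add: A_def finite_cube_faces)
  have K1: "{S \<in> kfaces Ts l fh fv. v \<in> \<Union>S} \<subseteq> (\<Union>i\<in>I. A b i)" for b
  proof
    fix S assume "S \<in> {S \<in> kfaces Ts l fh fv. v \<in> \<Union>S}"
    then have S: "S \<in> kfaces Ts l fh fv" "v \<in> \<Union>S" by simp_all
    obtain i where i: "i \<in> {1..l}" "S \<in> cube_faces (cube i) b"
    proof -
      obtain i j where "i \<in> {1..l}" "S \<in> cube_faces (cube i) True" "j \<in> {1..l}" "S \<in> cube_faces (cube j) False"
        using v S by (rule interior_face_upper_lower)
      then show thesis using that[of i] that[of j] by (cases b) simp_all
    qed
    have "i \<in> I" unfolding I_def cubes_at_def using i(1) face_in_corners[OF i(2) S(2)] by simp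
    moreover have "S \<in> A b i" unfolding A_def using i(2) S(2) by simp
    ultimately show "S \<in> (\<Union>i\<in>I. A b i)" by blast
  qed
  have K2: "A b i \<subseteq> {S \<in> kfaces Ts l fh fv. v \<in> \<Union>S}" if "i \<in> I" for b i
    using cube_faces_subset[of i b] that I(1) unfolding A_def by blast
  have K: "{S \<in> kfaces Ts l fh fv. v \<in> \<Union>S} = (\<Union>i\<in>I. A b i)" for b
    by (rule equalityI[OF K1]) (rule UN_least[OF K2])
  have "A b i \<inter> A b j = {}" if "i \<in> I" "j \<in> I" "i \<noteq> j" for b i j
  proof -
    have "i \<in> {1..l}" "j \<in> {1..l}" using that I(1) by auto
    then have "S \<notin> cube_faces (cube j) b" if "S \<in> cube_faces (cube i) b" for S
      using \<open>i \<noteq> j\<close> that upper_unique[of i j S] lower_unique[of i j S] by (cases b) auto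
    then show ?thesis unfolding A_def by auto
  qed
  then have P: "(\<Prod>S\<in>{S \<in> kfaces Ts l fh fv. v \<in> \<Union>S}. f S) = (\<Prod>i\<in>I. \<Prod>S\<in>A b i. f S)" for b
    unfolding K[of b] using I(2) fin by (intro prod.UNION_disjoint) auto
  have split: "(\<Prod>S\<in>{S \<in> cube_faces (cube i) False \<union> cube_faces (cube i) True. v \<in> \<Union>S}. f S)
      = (\<Prod>S\<in>A False i. f S) * (\<Prod>S\<in>A True i. f S)" if "i \<in> I" for i
  proof -
    have "{S \<in> cube_faces (cube i) False \<union> cube_faces (cube i) True. v \<in> \<Union>S} = A False i \<union> A True i"
      unfolding A_def by blast
    moreover have "A False i \<inter> A True i = {}"
      using upper_lower_less[of i i] that I(1) unfolding A_def by blast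
    ultimately show ?thesis using fin by (simp add: prod.union_disjoint)
  qed
  have "(\<Prod>i\<in>I. \<Prod>S\<in>{S \<in> cube_faces (cube i) False \<union> cube_faces (cube i) True. v \<in> \<Union>S}. f S)
      = (\<Prod>i\<in>I. \<Prod>S\<in>A False i. f S) * (\<Prod>i\<in>I. \<Prod>S\<in>A True i. f S)"
    unfolding prod.distrib[symmetric] by (rule prod.cong[OF refl split])
  also have "\<dots> = (\<Prod>S\<in>{S \<in> kfaces Ts l fh fv. v \<in> \<Union>S}. f S) * (\<Prod>S\<in>{S \<in> kfaces Ts l fh fv. v \<in> \<Union>S}. f S)"
    unfolding P[symmetric] ..
  also have "\<dots> = (\<Prod>S\<in>{S \<in> kfaces Ts l fh fv. v \<in> \<Union>S}. (f S)\<^sup>2)"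
    unfolding power2_eq_square prod.distrib ..
  finally show ?thesis unfolding I_def .
qed

text \<open>A vertex of \<open>Ts 0\<close> lies on a face of \<open>Ts 0\<close>, which no flip
  creates, so that face bounds no cube from above and the vertex is not interior.\<close>

lemma interior_is_top:
  assumes v: "interior_vertex Ts l fw fh fv v"
  obtains i where "i \<in> {1..l}" "v = cube i True True True"
proof -
  have "v \<in> kverts Ts l fv" using v unfolding interior_vertex_def by blast
  then consider p where "v = (p, 0)" "p \<in> \<Union>(qverts ` Ts 0)" | i where "v = (fv i, i)" "i \<in> {1..l}"
    unfolding kverts_def by blast
  then show thesis
  proof cases
    case 1
    then obtain E where E: "E \<in> Ts 0" "p \<in> qverts E" by blast
    define S where "S = lab_face fv 0 E"
    have "v \<in> \<Union>S" unfolding S_def Union_lab_face 1(1) using E(2) by simp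
    moreover have S: "S \<in> kfaces Ts 0 fh fv" unfolding S_def using E(1) by (intro lab_face_in_kfaces) simp
    moreover have "S \<in> kfaces Ts l fh fv" using kfaces_mono[of 0 l] S by blast
    ultimately obtain i where "i \<in> {1..l}" "S \<in> cube_faces (cube i) True"
      using interior_face_upper_lower[OF v, of S] by metis
    then have "i \<le> 0" using top_index_le[of 0 S i] S by simp
    then show thesis using \<open>i \<in> {1..l}\<close> by simp
  next
    case 2
    then show thesis using that[of i] by (simp add: kcube_simps)
  qed
qed

text \<open>Take the last cube at \<open>v\<close>. An upper face of it at \<open>v\<close> would be
  a lower face of a later cube at \<open>v\<close>; hence all three of its faces at \<open>v\<close>
  are lower.\<close>

lemma interior_is_bottom:
  assumes v: "interior_vertex Ts l fw fh fv v"
  obtains i where "i \<in> {1..l}" "v = cube i False False False"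
proof -
  define A where "A = cubes_at fw fh fv l v"
  have A: "i \<in> A \<longleftrightarrow> i \<in> {1..l} \<and> v \<in> corners (cube i)" for i
    unfolding A_def cubes_at_def by simp
  have "finite A" unfolding A_def cubes_at_def by simp
  obtain i0 where "i0 \<in> {1..l}" "v = cube i0 True True True" using v by (rule interior_is_top)
  then have "i0 \<in> A" unfolding A corners_def by blast
  define i where "i = Max A"
  have i: "i \<in> A" "\<And>j. j \<in> A \<Longrightarrow> j \<le> i"
    unfolding i_def using \<open>finite A\<close> \<open>i0 \<in> A\<close> by (auto intro: Max_in)
  then have il: "i \<in> {1..l}" using A by blast
  have no: False if "S \<in> cube_faces (cube i) True" "v \<in> \<Union>S" for S
  proof -
    have "S \<in> kfaces Ts l fh fv" using cube_faces_subset[OF il] that(1) by blast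
    from v this that(2) obtain j where j: "j \<in> {1..l}" "S \<in> cube_faces (cube j) False"
      by (rule interior_face_upper_lower)
    have "i < j" by (rule upper_lower_less[OF il j(1) that(1) j(2)])
    moreover have "j \<in> A" unfolding A using j(1) face_in_corners[OF j(2) that(2)] by simp
    ultimately show False using i(2) by fastforce
  qed
  obtain a b c where abc: "v = cube i a b c" using i(1) unfolding A corners_def by blast
  have "v \<in> \<Union>(face_x (cube i) a)" "v \<in> \<Union>(face_y (cube i) b)" "v \<in> \<Union>(face_z (cube i) c)"
    unfolding abc mem_cube_face[OF cube_inj_kcube[OF il]] by simp_all
  then have "\<not> a" "\<not> b" "\<not> c"
    using no[of "face_x (cube i) True"] no[of "face_y (cube i) True"] no[of "face_z (cube i) True"]
    unfolding cube_faces_def by (metis (full_types) insertI1 insertI2)+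
  then show thesis using that[OF il] abc by simp
qed

lemma bottom_unique:
  assumes "i \<in> {1..l}" "j \<in> {1..l}" "cube i False False False = cube j False False False"
  shows "i = j"
proof -
  have "\<not> i < j" if h: "i \<in> {1..l}" "j \<in> {1..l}" "cube i False False False = cube j False False False" for i j
  proof
    assume "i < j"
    have "face_x (cube j) False \<in> cube_faces (cube j) False" by (simp add: cube_faces_def)
    moreover from this obtain E where E: "E \<in> Ts (j - 1)" "face_x (cube j) False = lab_face fv (j - 1) E"
      using bottom_quads_subset[OF h(2)] unfolding lower_faces by blast
    ultimately have "cube i False False False \<in> \<Union>(lab_face fv (j - 1) E)"
      using bottom_in_lower h(3) by metis
    moreover have "i \<le> j - 1" "j - 1 \<le> l" using \<open>i < j\<close> h(2) by auto
    ultimately show False using bottom_gone[OF h(1) _ _ E(1)] by blast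
  qed
  then show ?thesis using assms by (metis linorder_neqE_nat)
qed

text \<open>The cubes at v are even in number, since each has three faces at v, each face at v lying in two cubes.
  Exactly two of these cubes have v as top or bottom vertex.\<close>
lemma prod_vertex_signs:
  assumes v: "interior_vertex Ts l fw fh fv v"
  shows "(\<Prod>i\<in>cubes_at fw fh fv l v. if v \<in> {cube i False False False, cube i True True True} then 1 else - 1)
    = (1 :: complex)"
proof -
  define I where "I = cubes_at fw fh fv l v"
  have I: "i \<in> I \<longleftrightarrow> i \<in> {1..l} \<and> v \<in> corners (cube i)" for i
    unfolding I_def cubes_at_def by simp
  have "finite I" unfolding I_def cubes_at_def by simp
  have three: "(\<Prod>S\<in>{S \<in> cube_faces (cube i) False \<union> cube_faces (cube i) True. v \<in> \<Union>S}. - 1 :: complex) = - 1"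
    if iI: "i \<in> I" for i
  proof -
    obtain a b c where "v = cube i a b c" using iI unfolding I corners_def by blast
    moreover have "cube_inj (cube i)" using iI cube_inj_kcube unfolding I by blast
    ultimately show ?thesis using prod_cube_faces_at[of "cube i" "\<lambda>_. - 1 :: complex" a b c] by simp
  qed
  \<comment> \<open>Double counting with the constant -1: each cube contributes three factors, that
    is -1, while every face contributes the square 1.\<close>
  have even: "(\<Prod>i\<in>I. - 1 :: complex) = 1"
    using prod_cubes_at_faces[OF v, of "\<lambda>_. - 1 :: complex"] three unfolding I_def by simp
  obtain t where t: "t \<in> {1..l}" "v = cube t True True True" using v by (rule interior_is_top)
  obtain b where b: "b \<in> {1..l}" "v = cube b False False False" using v by (rule interior_is_bottom)
  have "t \<in> I" "b \<in> I" using t b unfolding I corners_def by blast+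
  have tu: "v = cube i True True True \<longleftrightarrow> i = t" if "i \<in> I" for i
    unfolding t(2) kcube_simps by auto
  have bu: "v = cube i False False False \<longleftrightarrow> i = b" if "i \<in> I" for i
  proof -
    have "i \<in> {1..l}" using that unfolding I by blast
    then show ?thesis using bottom_unique[of i b] b by metis
  qed
  have "b \<noteq> t"
    using t(2) b(2) cube_injD[OF cube_inj_kcube[OF t(1)]] by metis
  \<comment> \<open>Starting from -1 on every cube, the sign is corrected at the two different
    indices \<open>b\<close> and \<open>t\<close>, and the corrections cancel.\<close>
  have "(\<Prod>i\<in>I. if v \<in> {cube i False False False, cube i True True True} then 1 else - 1 :: complex)
      = (\<Prod>i\<in>I. - 1 * (if i = b then - 1 else 1) * (if i = t then - 1 else 1))"
    using tu bu \<open>b \<noteq> t\<close> by (intro prod.cong) auto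
  also have "\<dots> = 1"
    unfolding prod.distrib even using \<open>finite I\<close> \<open>t \<in> I\<close> \<open>b \<in> I\<close> by simp
  finally show ?thesis unfolding I_def .
qed

lemma fclass_eq:
  assumes "opp_faces fw fh fv l s s'"
  shows "fclass fw fh fv l s = fclass fw fh fv l s'"
proof -
  have e: "equivclp (opp_faces fw fh fv l) s s'" using assms by (rule r_into_equivclp)
  show ?thesis unfolding fclass_def
    using equivclp_trans[OF e] equivclp_trans[OF equivclp_sym[OF e]] by blast
qed

lemma fclass_opposite:
  assumes "i \<in> {1..l}"
  shows "fclass fw fh fv l (face_x (cube i) True) = fclass fw fh fv l (face_x (cube i) False)"
    "fclass fw fh fv l (face_y (cube i) True) = fclass fw fh fv l (face_y (cube i) False)"
    "fclass fw fh fv l (face_z (cube i) True) = fclass fw fh fv l (face_z (cube i) False)"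
proof -
  have "opp_faces fw fh fv l (face_x (cube i) False) (face_x (cube i) True)"
    "opp_faces fw fh fv l (face_y (cube i) False) (face_y (cube i) True)"
    "opp_faces fw fh fv l (face_z (cube i) False) (face_z (cube i) True)"
    unfolding opp_faces_def Let_def by (rule bexI[OF _ assms]; simp only: simp_thms)+
  note this[THEN fclass_eq, symmetric]
  then show "fclass fw fh fv l (face_x (cube i) True) = fclass fw fh fv l (face_x (cube i) False)"
    "fclass fw fh fv l (face_y (cube i) True) = fclass fw fh fv l (face_y (cube i) False)"
    "fclass fw fh fv l (face_z (cube i) True) = fclass fw fh fv l (face_z (cube i) False)" .
qed

text \<open>Induction over the flips: a flip adds only new faces, so their values can be prescribed
  by the formulas without disturbing the earlier cubes.\<close>

lemma signed_khex_exists: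
  assumes K: "\<forall>i\<in>{1..l}. KC (cube i) x = 0"
    and nz: "\<forall>v\<in>kverts Ts l fv. x v \<noteq> 0"
    and fnz: "\<forall>S\<in>kfaces Ts l fh fv. \<forall>v1 v2 v3 v4. S = cyc v1 v2 v3 v4 \<longrightarrow> x v1 * x v3 + x v2 * x v4 \<noteq> 0"
  shows "m \<le> l \<Longrightarrow> \<exists>y u. (\<forall>S\<in>kfaces Ts m fh fv. face_root x y S) \<and> (\<forall>i\<in>{1..m}. signed_khex (cube i) x y (u i))"
proof (induction m)
  case 0
  have "\<exists>y. face_root x y S" if "S \<in> kfaces Ts 0 fh fv" for S
  proof -
    have "S \<in> kfaces Ts l fh fv" using kfaces_mono[of 0 l] that by blast
    then obtain a b c d where S: "S = cyc a b c d" "distinct [a, b, c, d]" by (rule kface_cyc)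
    have "face_root x (\<lambda>_. csqrt (x a * x c + x b * x d)) (cyc a b c d)"
      by (rule face_rootI[OF S(2)]) simp
    then show ?thesis unfolding S(1) by blast
  qed
  then obtain Y where "\<And>S. S \<in> kfaces Ts 0 fh fv \<Longrightarrow> face_root x (Y S) S" by metis
  \<comment> \<open>\<open>face_root\<close> at \<open>S\<close> depends only on the value at
    \<open>S\<close>, so the separate choices can be merged along the diagonal.\<close>
  then have "\<forall>S\<in>kfaces Ts 0 fh fv. face_root x (\<lambda>S. Y S S) S" by (simp add: face_root_def)
  then show ?case by auto
next
  case (Suc m)
  then obtain y u where y: "\<And>S. S \<in> kfaces Ts m fh fv \<Longrightarrow> face_root x y S"
    and u: "\<And>i. i \<in> {1..m} \<Longrightarrow> signed_khex (cube i) x y (u i)" by (meson Suc_leD)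
  define n where "n = Suc m"
  have n: "n \<in> {1..l}" using Suc.prems by (simp add: n_def)
  define g where "g = cube n"
  have inj: "cube_inj g" unfolding g_def using n by (rule cube_inj_kcube)
  have lowK: "cube_faces g False \<subseteq> kfaces Ts m fh fv"
    using lower_faces_subset[OF n] by (simp add: g_def n_def)
  have new: "S \<notin> kfaces Ts m fh fv" if "S \<in> cube_faces g True" for S
  proof
    assume "S \<in> kfaces Ts m fh fv"
    then have "n \<le> m" using that Suc.prems unfolding g_def by (intro top_index_le[of m S n]) simp_all
    then show False by (simp add: n_def)
  qed
  define X0 Y0 Z0 where "X0 = y (face_x g False)" and "Y0 = y (face_y g False)" and "Z0 = y (face_z g False)"
  have low: "face_x g False \<in> cube_faces g False" "face_y g False \<in> cube_faces g False" "face_z g False \<in> cube_faces g False"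
    by (simp_all add: cube_faces_def)
  have sq: "X0\<^sup>2 = x (g False False False) * x (g False True True) + x (g False True False) * x (g False False True)"
    "Y0\<^sup>2 = x (g False False False) * x (g True False True) + x (g True False False) * x (g False False True)"
    "Z0\<^sup>2 = x (g False False False) * x (g True True False) + x (g True False False) * x (g False True False)"
    using low[THEN subsetD[OF lowK], THEN y] unfolding face_root_def face_x_def face_y_def face_z_def X0_def Y0_def Z0_def
    by blast+
  have lowl: "cube_faces g False \<subseteq> kfaces Ts l fh fv" unfolding g_def using n by (rule cube_faces_subset)
  have "X0\<^sup>2 \<noteq> 0" "Y0\<^sup>2 \<noteq> 0" "Z0\<^sup>2 \<noteq> 0"
    unfolding sq using low[THEN subsetD[OF lowl], THEN bspec[OF fnz]] unfolding face_x_def face_y_def face_z_def by blast+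
  then have nz3: "X0 \<noteq> 0" "Y0 \<noteq> 0" "Z0 \<noteq> 0" by auto
  \<comment> \<open>The value forced by the bottom vertex; it squares to 1 by
    \<open>KC0_square\<close>.\<close>
  define w where "w = KC0 g x / (X0 * Y0 * Z0)"
  have "(KC0 g x)\<^sup>2 = X0\<^sup>2 * Y0\<^sup>2 * Z0\<^sup>2"
    unfolding sq by (rule KC0_square) (use K n in \<open>simp add: g_def\<close>)
  then have w: "w * w = 1" "KC0 g x = w * X0 * Y0 * Z0"
    using nz3 by (simp_all add: w_def power2_eq_square field_simps)
  define x0 where "x0 = x (g False False False)"
  have "g False False False \<in> \<Union>(face_x g False)" by (simp only: mem_cube_face[OF inj])
  then have x0: "x (g False False False) \<noteq> 0" using nz kface_verts subsetD[OF lowl low(1)] by blast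
  define y' where "y' = y
    (face_x g True := (w * Y0 * Z0 + X0 * x (g True False False)) / x0,
     face_y g True := (w * X0 * Z0 + Y0 * x (g False True False)) / x0,
     face_z g True := (w * X0 * Y0 + Z0 * x (g False False True)) / x0)"
  have old: "y' S = y S" if "S \<in> kfaces Ts m fh fv" for S
  proof -
    have "S \<noteq> face_x g True" "S \<noteq> face_y g True" "S \<noteq> face_z g True"
      using new that by (auto simp: cube_faces_def)
    then show ?thesis by (simp add: y'_def)
  qed
  have oldroot: "face_root x y' S" if "S \<in> kfaces Ts m fh fv" for S
    using y[OF that] unfolding face_root_def old[OF that] .
  have yl: "y' (face_x g False) = X0" "y' (face_y g False) = Y0" "y' (face_z g False) = Z0"
    using old low lowK by (auto simp: X0_def Y0_def Z0_def)
  have yu: "y' (face_x g True) = (w * Y0 * Z0 + X0 * x (g True False False)) / x0"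
    "y' (face_y g True) = (w * X0 * Z0 + Y0 * x (g False True False)) / x0"
    "y' (face_z g True) = (w * X0 * Y0 + Z0 * x (g False False True)) / x0"
    using cube_faces_distinct[OF inj] by (simp_all add: y'_def)
  have hex: "signed_khex g x y' w"
    unfolding signed_khex_def yl yu x0_def using w by simp
  have up: "face_root x y' S" if S: "S \<in> cube_faces g True" for S
  proof -
    have lr: "\<And>S. S \<in> cube_faces g False \<Longrightarrow> face_root x y' S" using oldroot lowK by blast
    note r = signed_khex_vertex(2-4)[OF x0 hex lr]
    consider "S = face_x g True" | "S = face_y g True" | "S = face_z g True"
      using S unfolding cube_faces_def by blast
    then show ?thesis
    proof cases
      case 1
      show ?thesis unfolding 1 face_x_def
        by (rule face_rootI) (use r(1) cube_injD[OF inj] in \<open>simp_all add: face_x_def\<close>)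
    next
      case 2
      show ?thesis unfolding 2 face_y_def
        by (rule face_rootI) (use r(2) cube_injD[OF inj] in \<open>simp_all add: face_y_def\<close>)
    next
      case 3
      show ?thesis unfolding 3 face_z_def
        by (rule face_rootI) (use r(3) cube_injD[OF inj] in \<open>simp_all add: face_z_def\<close>)
    qed
  qed
  have "kfaces Ts n fh fv = kfaces Ts m fh fv \<union> cube_faces g True"
    using Suc.prems kfaces_eq[of m] kfaces_eq[of n] by (auto simp: n_def g_def atLeastAtMostSuc_conv)
  then have roots: "\<forall>S\<in>kfaces Ts n fh fv. face_root x y' S" using oldroot up by blast
  have hexes: "signed_khex (cube i) x y' ((u(n := w)) i)" if i: "i \<in> {1..n}" for i
  proof (cases "i = n")
    case True
    then show ?thesis using hex by (simp add: g_def)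
  next
    case False
    then have im: "i \<in> {1..m}" using i by (auto simp: n_def)
    then have "i \<in> {1..l}" using n by (auto simp: n_def)
    then have sub: "cube_faces (cube i) b \<subseteq> kfaces Ts m fh fv" for b
      using lower_faces_subset[of i] upper_faces_subset[of i] kfaces_mono[of "i - 1" m] kfaces_mono[of i m]
        le_trans[OF diff_le_self[of i 1], of m] im Suc.prems
      by (cases b) auto
    have "face_x (cube i) b \<in> cube_faces (cube i) b" "face_y (cube i) b \<in> cube_faces (cube i) b"
      "face_z (cube i) b \<in> cube_faces (cube i) b" for b
      by (simp_all add: cube_faces_def)
    note this[THEN subsetD[OF sub], THEN old]
    then show ?thesis using u[OF im] False by (simp add: signed_khex_def)
  qed
  show ?case using roots hexes unfolding n_def[symmetric] by blast
qed

lemma khexahedron_exists: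
  assumes comf: "comfortable Ts l fw fh fv"
    and cohk: "coherent_kashaev Ts l fw fh fv x"
    and nz: "\<forall>v\<in>kverts Ts l fv. x v \<noteq> 0"
    and fnz: "\<forall>S\<in>kfaces Ts l fh fv. \<forall>v1 v2 v3 v4. S = cyc v1 v2 v3 v4 \<longrightarrow> x v1 * x v3 + x v2 * x v4 \<noteq> 0"
  shows "\<exists>y. khexahedron Ts l fw fh fv x y"
proof -
  have KC: "\<forall>i\<in>{1..l}. KC (cube i) x = 0"
    and coh: "\<And>v. interior_vertex Ts l fw fh fv v \<Longrightarrow> (\<Prod>i\<in>cubes_at fw fh fv l v. KCv (cube i) v x)
      = (\<Prod>S\<in>{S \<in> kfaces Ts l fh fv. v \<in> \<Union>S}. face_term x v S)"
    using cohk unfolding coherent_kashaev_def by blast+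
  obtain y u where root: "\<forall>S\<in>kfaces Ts l fh fv. face_root x y S"
    and hex: "\<forall>i\<in>{1..l}. signed_khex (cube i) x y (u i)"
    using signed_khex_exists[OF KC nz fnz order_refl] by blast
  have uu: "u i = 1 \<or> u i = - 1" if "i \<in> {1..l}" for i
  proof -
    have "(u i)\<^sup>2 = 1" using hex that by (simp add: signed_khex_def power2_eq_square)
    then show ?thesis by (simp add: power2_eq_1_iff)
  qed
  have nz0: "x (cube i False False False) \<noteq> 0" if "i \<in> {1..l}" for i
  proof -
    have "face_x (cube i) False \<in> cube_faces (cube i) False" by (simp add: cube_faces_def)
    then have "face_x (cube i) False \<in> kfaces Ts l fh fv" using cube_faces_subset[OF that] by blast
    moreover have "cube i False False False \<in> \<Union>(face_x (cube i) False)"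
      by (simp only: mem_cube_face[OF cube_inj_kcube[OF that]])
    ultimately show ?thesis using kface_verts nz by blast
  qed
  have KCv: "KCv (cube i) v x = (if v \<in> {cube i False False False, cube i True True True} then 1 else - 1) * u i
      * (\<Prod>S\<in>{S \<in> cube_faces (cube i) False \<union> cube_faces (cube i) True. v \<in> \<Union>S}. y S)"
    if i: "i \<in> cubes_at fw fh fv l v" for i v
  proof -
    have il: "i \<in> {1..l}" using i unfolding cubes_at_def by blast
    obtain a b c where v: "v = cube i a b c" using i unfolding cubes_at_def corners_def by blast
    note inj = cube_inj_kcube[OF il]
    have lower: "\<And>S. S \<in> cube_faces (cube i) False \<Longrightarrow> face_root x y S"
      using root cube_faces_subset[OF il] by blast
    have "v \<in> {cube i False False False, cube i True True True} \<longleftrightarrow> a = b \<and> b = c"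
      unfolding v using cube_injD[OF inj] by auto
    then show ?thesis
      unfolding v KCv_eq[OF inj] prod_cube_faces_at[OF inj]
      using signed_khex_vertex(1)[OF nz0[OF il] bspec[OF hex il] lower, of a b c] by simp
  qed
  \<comment> \<open>Comfort quantifies over integer signs, so the complex signs are transferred;
    outside the pile any value in {-1, 1} will do.\<close>
  define ui :: "nat \<Rightarrow> int" where "ui i = (if u i = 1 then 1 else - 1)" for i
  have ui: "of_int (ui i) = u i" if "i \<in> {1..l}" for i using uu[OF that] by (auto simp: ui_def)
  have prod1: "(\<Prod>i\<in>cubes_at fw fh fv l v. ui i) = 1" if v: "interior_vertex Ts l fw fh fv v" for v
  proof -
    let ?I = "cubes_at fw fh fv l v" and ?K = "{S \<in> kfaces Ts l fh fv. v \<in> \<Union>S}"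
    have ft: "face_term x v S = (y S)\<^sup>2 \<and> (y S)\<^sup>2 \<noteq> 0" if S: "S \<in> ?K" for S
    proof -
      have SK: "S \<in> kfaces Ts l fh fv" "v \<in> \<Union>S" using S by blast+
      obtain a b c d where abcd: "S = cyc a b c d" using SK(1) by (rule kface_cyc)
      have r: "face_root x y S" using root SK(1) by (rule bspec)
      then have "(y S)\<^sup>2 = x a * x c + x b * x d" using abcd unfolding face_root_def by blast
      moreover have "x a * x c + x b * x d \<noteq> 0" using fnz SK(1) abcd by blast
      ultimately show ?thesis using face_term_root[OF abcd SK(2) r] by simp
    qed
    have "(\<Prod>S\<in>?K. (y S)\<^sup>2) = (\<Prod>S\<in>?K. face_term x v S)"
      using ft by (intro prod.cong) auto
    also have "\<dots> = (\<Prod>i\<in>?I. KCv (cube i) v x)" using coh[OF v] by simp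
    also have "\<dots> = (\<Prod>i\<in>?I. (if v \<in> {cube i False False False, cube i True True True} then 1 else - 1) * u i
      * (\<Prod>S\<in>{S \<in> cube_faces (cube i) False \<union> cube_faces (cube i) True. v \<in> \<Union>S}. y S))"
      by (rule prod.cong[OF refl KCv])
    also have "\<dots> = (\<Prod>i\<in>?I. u i) * (\<Prod>S\<in>?K. (y S)\<^sup>2)"
      unfolding prod.distrib prod_vertex_signs[OF v] prod_cubes_at_faces[OF v] by simp
    finally have "(\<Prod>S\<in>?K. (y S)\<^sup>2) = (\<Prod>i\<in>?I. u i) * (\<Prod>S\<in>?K. (y S)\<^sup>2)" .
    \<comment> \<open>Nonvanishing face terms let the product of squares cancel, leaving only the
      cube signs.\<close>
    moreover have "(\<Prod>S\<in>?K. (y S)\<^sup>2) \<noteq> 0"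
      using finite_kfaces ft by (simp add: prod_zero_iff)
    ultimately have "(\<Prod>i\<in>?I. u i) = 1" by simp
    moreover have "(\<Prod>i\<in>?I. u i) = (\<Prod>i\<in>?I. of_int (ui i))"
      using ui by (intro prod.cong) (auto simp: cubes_at_def)
    ultimately have "of_int (\<Prod>i\<in>?I. ui i) = (of_int 1 :: complex)" by simp
    then show ?thesis by (simp only: of_int_eq_iff)
  qed
  have "\<exists>t :: kv set set set \<Rightarrow> int. (\<forall>C\<in>fclass fw fh fv l ` kfaces Ts l fh fv. t C \<in> {- 1, 1})
      \<and> (\<forall>i\<in>{1..l}. ui i = psi fw fh fv l t i)"
    using comf[unfolded comfortable_def, rule_format, of ui] prod1 by (simp add: ui_def)
  then obtain t :: "kv set set set \<Rightarrow> int" where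
    t: "\<forall>C\<in>fclass fw fh fv l ` kfaces Ts l fh fv. t C \<in> {- 1, 1}"
    and psi: "\<forall>i\<in>{1..l}. ui i = psi fw fh fv l t i" by blast
  define \<epsilon> :: "kv set set \<Rightarrow> complex" where "\<epsilon> S = of_int (t (fclass fw fh fv l S))" for S
  have \<epsilon>: "\<epsilon> S * \<epsilon> S = 1" if "S \<in> kfaces Ts l fh fv" for S
  proof -
    have "t (fclass fw fh fv l S) \<in> {- 1, 1}" using t that by blast
    then show ?thesis unfolding \<epsilon>_def by auto
  qed
  define y' where "y' S = \<epsilon> S * y S" for S
  have "khexahedron Ts l fw fh fv x y'"
    unfolding khexahedron_def
  proof (intro conjI ballI allI impI)
    show "x v \<noteq> 0" if "v \<in> kverts Ts l fv" for v using nz that by blast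
  next
    fix S v1 v2 v3 v4 assume S: "S \<in> kfaces Ts l fh fv" "S = cyc v1 v2 v3 v4"
    have "(y' S)\<^sup>2 = (\<epsilon> S * \<epsilon> S) * (y S)\<^sup>2" by (simp add: y'_def power2_eq_square)
    also have "\<dots> = x v1 * x v3 + x v2 * x v4"
    proof -
      have "(y S)\<^sup>2 = x v1 * x v3 + x v2 * x v4"
        using bspec[OF root S(1)] S(2) unfolding face_root_def by blast
      then show ?thesis by (simp add: \<epsilon>[OF S(1)])
    qed
    finally show "(y' S)\<^sup>2 = x v1 * x v3 + x v2 * x v4" .
  next
    fix i assume i: "i \<in> {1..l}"
    let ?g = "cube i"
    define a b c where "a = \<epsilon> (face_x ?g False)" and "b = \<epsilon> (face_y ?g False)" and "c = \<epsilon> (face_z ?g False)"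
    \<comment> \<open>Opposite faces lie in one class, so a cube involves just three signs, one for
      each axis, and their product is \<open>u i\<close>.\<close>
    have up: "\<epsilon> (face_x ?g True) = a" "\<epsilon> (face_y ?g True) = b" "\<epsilon> (face_z ?g True) = c"
      unfolding \<epsilon>_def a_def b_def c_def fclass_opposite[OF i] by (rule refl)+
    have sq: "a * a = 1" "b * b = 1" "c * c = 1"
      unfolding a_def b_def c_def using cube_faces_subset[OF i, of False]
      by (auto intro!: \<epsilon> simp: cube_faces_def)
    have uabc: "u i = a * b * c"
      using ui[OF i] psi i unfolding psi_def Let_def a_def b_def c_def \<epsilon>_def by simp
    define p q r z where "p = y (face_x ?g False)" and "q = y (face_y ?g False)" and "r = y (face_z ?g False)"
      and "z = x (?g False False False)"
    have z: "z \<noteq> 0" unfolding z_def by (rule nz0[OF i])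
    have h: "KC0 ?g x = a * b * c * p * q * r"
      "y (face_x ?g True) = (a * b * c * q * r + p * x (?g True False False)) / z"
      "y (face_y ?g True) = (a * b * c * p * r + q * x (?g False True False)) / z"
      "y (face_z ?g True) = (a * b * c * p * q + r * x (?g False False True)) / z"
      using bspec[OF hex i] unfolding signed_khex_def uabc p_def q_def r_def z_def by blast+
    \<comment> \<open>In each line one squared sign disappears; for the first,
      \<open>a * u i * q * r\<close> becomes the product of the corrected values
      \<open>b * q\<close> and \<open>c * r\<close>.\<close>
    have "a * (a * b * c * q * r + p * x (?g True False False)) = b * q * (c * r) + a * p * x (?g True False False)"
      "b * (a * b * c * p * r + q * x (?g False True False)) = a * p * (c * r) + b * q * x (?g False True False)"
      "c * (a * b * c * p * q + r * x (?g False False True)) = a * p * (b * q) + c * r * x (?g False False True)"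
      using sq by algebra+
    moreover have "x (?g True True True) * z\<^sup>2 = 2 * x (?g True False False) * x (?g False True False) * x (?g False False True)
        + z * (x (?g True False False) * x (?g False True True) + x (?g False True False) * x (?g True False True)
          + x (?g False False True) * x (?g True True False)) + 2 * (a * p) * (b * q) * (c * r)"
      using h(1) unfolding KC0_def Let_def z_def[symmetric] by (simp add: field_simps)
    then have "x (?g True True True) = (2 * x (?g True False False) * x (?g False True False) * x (?g False False True)
        + z * (x (?g True False False) * x (?g False True True) + x (?g False True False) * x (?g True False True)
          + x (?g False False True) * x (?g True True False)) + 2 * (a * p) * (b * q) * (c * r)) / z\<^sup>2"
      using z by (simp add: eq_divide_eq)
    ultimately show "khex_cube ?g x y'"
      unfolding khex_cube_def Let_def y'_def up h(2-4) a_def[symmetric] b_def[symmetric] c_def[symmetric]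
        p_def[symmetric] q_def[symmetric] r_def[symmetric] z_def[symmetric] times_divide_eq_right
      by simp
  qed
  then show ?thesis by blast
qed

end

theorem theorem8p10:
  fixes Ts :: "nat \<Rightarrow> pt set set set" and l :: nat
    and fw fv :: "nat \<Rightarrow> pt" and fh :: "nat \<Rightarrow> nat \<Rightarrow> pt"
    and x :: "kv \<Rightarrow> complex"
  assumes "pile Ts l fw fh fv"
    and "comfortable Ts l fw fh fv"
    and "coherent_kashaev Ts l fw fh fv x"
    and "\<forall>v\<in>kverts Ts l fv. x v \<noteq> 0"
    and "\<forall>S\<in>kfaces Ts l fh fv. \<forall>v1 v2 v3 v4. S = cyc v1 v2 v3 v4 \<longrightarrow> x v1 * x v3 + x v2 * x v4 \<noteq> 0"
  shows "\<exists>y :: kv set set \<Rightarrow> complex. khexahedron Ts l fw fh fv x y"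
  using assms by (rule khexahedron_exists)

end
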